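(* Let $G$ be a finite simple graph that is $3$-connected and star-like. Then $G$ has a 3-decomposition, i.e., the edge set of $G$ can be partitioned into the edge sets of a spanning tree of $G$, a $2$-regular subgraph of $G$ (possibly empty), and a matching of $G$ (possibly empty).
   Context: A graph $G$ is cubic if every vertex has degree $3$. For a connected cubic graph $G$ with a perfect matching $M$, the graph $G-M$ is a disjoint union of cycles; contracting each of these cycles to a single vertex yields the contraction graph $G_M$, which has one vertex per cycle of $G-M$ and an edge between two vertices whenever the corresponding cycles are joined by an edge of $M$. The graph $G$ is star-like if it is a connected cubic graph having a perfect matching $M$ such that $G_M$ is a star (a tree of diameter at most $2$). *)

theory Defs
  imports Main
begin

text \<open>
  Undirected graphs, with each edge the set of its two ends. The AFP entry Graph_Theory models
  undirected graphs as symmetric digraphs, where every edge is already a cycle of length two, so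
  that its notion of a tree is not the undirected one.
\<close>

record 'a ugraph =
  vertices :: "'a set"
  edges :: "'a set set"

definition finite_simple_graph :: "'a ugraph \<Rightarrow> bool" where
  "finite_simple_graph G \<longleftrightarrow>
     finite (vertices G) \<and> (\<forall>e\<in>edges G. e \<subseteq> vertices G \<and> card e = 2)"

definition subgraph_of :: "'a ugraph \<Rightarrow> 'a ugraph \<Rightarrow> bool" where
  "subgraph_of H G \<longleftrightarrow>
     finite_simple_graph H \<and> vertices H \<subseteq> vertices G \<and> edges H \<subseteq> edges G"

definition degree_of :: "'a ugraph \<Rightarrow> 'a \<Rightarrow> nat" where
  "degree_of G v = card {e \<in> edges G. v \<in> e}"

definition regular_graph :: "nat \<Rightarrow> 'a ugraph \<Rightarrow> bool" where
  "regular_graph k G \<longleftrightarrow> (\<forall>v\<in>vertices G. degree_of G v = k)"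

definition cubic_graph :: "'a ugraph \<Rightarrow> bool" where
  "cubic_graph G \<longleftrightarrow> regular_graph 3 G"

definition delete_edges :: "'a ugraph \<Rightarrow> 'a set set \<Rightarrow> 'a ugraph" where
  "delete_edges G F = \<lparr>vertices = vertices G, edges = edges G - F\<rparr>"

definition delete_vertices :: "'a ugraph \<Rightarrow> 'a set \<Rightarrow> 'a ugraph" where
  "delete_vertices G X = \<lparr>vertices = vertices G - X, edges = {e \<in> edges G. e \<inter> X = {}}\<rparr>"

text \<open>A walk is its nonempty list of vertices, so its length is one less than that of the list.\<close>

definition graph_walk :: "'a ugraph \<Rightarrow> 'a \<Rightarrow> 'a list \<Rightarrow> 'a \<Rightarrow> bool" where
  "graph_walk G u p v \<longleftrightarrow>
     p \<noteq> [] \<and> hd p = u \<and> last p = v \<and> set p \<subseteq> vertices G \<and>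
     successively (\<lambda>x y. {x, y} \<in> edges G) p"

definition connected_graph :: "'a ugraph \<Rightarrow> bool" where
  "connected_graph G \<longleftrightarrow>
     vertices G \<noteq> {} \<and> (\<forall>u\<in>vertices G. \<forall>v\<in>vertices G. \<exists>p. graph_walk G u p v)"

definition k_connected :: "nat \<Rightarrow> 'a ugraph \<Rightarrow> bool" where
  "k_connected k G \<longleftrightarrow>
     card (vertices G) > k \<and>
     (\<forall>X \<subseteq> vertices G. card X < k \<longrightarrow> connected_graph (delete_vertices G X))"

definition graph_cycle :: "'a ugraph \<Rightarrow> 'a list \<Rightarrow> bool" where
  "graph_cycle G p \<longleftrightarrow>
     length p \<ge> 3 \<and> distinct p \<and> graph_walk G (hd p) p (last p) \<and> {last p, hd p} \<in> edges G"

definition tree_graph :: "'a ugraph \<Rightarrow> bool" where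
  "tree_graph G \<longleftrightarrow> connected_graph G \<and> (\<nexists>p. graph_cycle G p)"

definition spanning_tree_of :: "'a ugraph \<Rightarrow> 'a ugraph \<Rightarrow> bool" where
  "spanning_tree_of T G \<longleftrightarrow> subgraph_of T G \<and> vertices T = vertices G \<and> tree_graph T"

text \<open>The following two notions are meaningful only for (finite) connected graphs.\<close>

definition graph_distance :: "'a ugraph \<Rightarrow> 'a \<Rightarrow> 'a \<Rightarrow> nat" where
  "graph_distance G u v = (LEAST n. \<exists>p. graph_walk G u p v \<and> length p = Suc n)"

definition graph_diameter :: "'a ugraph \<Rightarrow> nat" where
  "graph_diameter G = Max {graph_distance G u v | u v. u \<in> vertices G \<and> v \<in> vertices G}"

definition star_graph :: "'a ugraph \<Rightarrow> bool" where
  "star_graph G \<longleftrightarrow> tree_graph G \<and> graph_diameter G \<le> 2"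

definition matching_of :: "'a set set \<Rightarrow> 'a ugraph \<Rightarrow> bool" where
  "matching_of M G \<longleftrightarrow> M \<subseteq> edges G \<and> (\<forall>e\<in>M. \<forall>f\<in>M. e \<noteq> f \<longrightarrow> e \<inter> f = {})"

definition perfect_matching_of :: "'a set set \<Rightarrow> 'a ugraph \<Rightarrow> bool" where
  "perfect_matching_of M G \<longleftrightarrow> matching_of M G \<and> (\<forall>v\<in>vertices G. \<exists>e\<in>M. v \<in> e)"

text \<open>
  A cycle of \<open>G - M\<close> is represented by its vertex set, which determines it when \<open>G\<close> is cubic and
  \<open>M\<close> is a perfect matching, as \<open>G - M\<close> is then 2-regular. The contraction graph is simple:
  chords of a cycle give no loops, and several edges of \<open>M\<close> between the same two cycles give a
  single edge.
\<close>

definition contraction_graph :: "'a ugraph \<Rightarrow> 'a set set \<Rightarrow> 'a set ugraph" where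
  "contraction_graph G M =
     (let \<C> = {set p | p. graph_cycle (delete_edges G M) p}
      in \<lparr>vertices = \<C>,
          edges = {{C, D} | C D. C \<in> \<C> \<and> D \<in> \<C> \<and> C \<noteq> D \<and> (\<exists>u\<in>C. \<exists>v\<in>D. {u, v} \<in> M)}\<rparr>)"

definition star_like :: "'a ugraph \<Rightarrow> bool" where
  "star_like G \<longleftrightarrow>
     connected_graph G \<and> cubic_graph G \<and>
     (\<exists>M. perfect_matching_of M G \<and> star_graph (contraction_graph G M))"

definition three_decomposition :: "'a ugraph \<Rightarrow> 'a ugraph \<Rightarrow> 'a ugraph \<Rightarrow> 'a set set \<Rightarrow> bool" where
  "three_decomposition G T H N \<longleftrightarrow>
     spanning_tree_of T G \<and>
     subgraph_of H G \<and> regular_graph 2 H \<and>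
     matching_of N G \<and>
     edges G = edges T \<union> edges H \<union> N \<and>
     edges T \<inter> edges H = {} \<and> edges T \<inter> N = {} \<and> edges H \<inter> N = {}"

end

(*
  Let P be a shortest arc of the central cycle whose ends are matched to each other or to the same
  outer cycle. In the first case P and its chord form a cycle; in the second, P is closed up by a
  path through that outer cycle U, chosen nonseparating as in Tutte's theorem on peripheral cycles.
  Every other outer cycle sends at most one matching edge to P. Inside such a cycle one finds either
  an induced cycle that avoids the end of this edge and does not cut anything off from the centre, or
  a Hamiltonian path that starts at this end and finishes at another vertex matched to the centre.
  The 2-regular graph consists of all cycles found. The tree contains the edges leaving them, the
  surviving arcs of the cycles of G - M, the Hamiltonian paths, and enough further edges of M; what
  remains is a matching.
*)

theory Submission
  imports Defs
begin

section \<open>Lists as cycles and paths\<close>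

text \<open>A vertex of the 2-regular graph has a single further edge, which the spanning tree
  needs, so these vertices are leaves of the tree and the problem moves to the vertices outside.
  There every cycle of \<open>G - M\<close> has to be broken without disconnecting anything, while
  an edge put into the matching forces all other edges at its ends into the tree or the 2-regular
  graph. The obstacle is an outer cycle that the 2-regular graph avoids. The edges off its
  Hamiltonian path go into the matching, which may force the edge of \<open>M\<close> at both ends
  of the path; two such links to the centre could close a cycle. Starting the path at the vertex
  matched to \<open>P\<close> turns one link into a leaf edge, and one link is harmless. Beyond
  plain connectedness, 3-connectivity serves twice: an outer cycle has at least three edges to the
  centre, so an exit remains when one edge is lost to \<open>P\<close>, and no two vertices of the
  path through \<open>U\<close> cut off a part of \<open>U\<close>.\<close>

definition cyc :: "('a \<Rightarrow> 'a \<Rightarrow> bool) \<Rightarrow> 'a list \<Rightarrow> bool" where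
  "cyc r p \<longleftrightarrow> length p \<ge> 3 \<and> distinct p \<and> successively r p \<and> r (last p) (hd p)"

lemma cyc_rotate: "cyc r (xs @ ys) \<Longrightarrow> cyc r (ys @ xs)"
  by (cases "xs = []"; cases "ys = []") (auto simp: cyc_def successively_append_iff)

lemma cyc_rev:
  assumes "symp r" "cyc r p" shows "cyc r (rev p)"
proof -
  have "(\<lambda>x y. r y x) = r" using assms(1) by (auto simp: symp_def fun_eq_iff)
  then show ?thesis
    using assms by (simp add: cyc_def hd_rev last_rev symp_def) metis
qed

lemma cyc_start:
  assumes "cyc r p" "v \<in> set p"
  obtains q where "cyc r (v # q)" "set (v # q) = set p"
proof -
  obtain xs ys where p: "p = xs @ v # ys" using assms(2) by (meson split_list)
  show thesis
    using that[of "ys @ xs"] cyc_rotate[of r xs "v # ys"] assms(1) p by auto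
qed

lemma cyc_Cons_iff:
  "cyc r (v # q) \<longleftrightarrow> length q \<ge> 2 \<and> distinct (v # q) \<and> r v (hd q) \<and> successively r q \<and> r (last q) v"
  by (cases q) (auto simp: cyc_def)

lemma hd_neq_last: "distinct q \<Longrightarrow> length q \<ge> 2 \<Longrightarrow> hd q \<noteq> last q"
  by (cases q) auto

text \<open>Ordered and without wrap-around: the closing edge of a cycle is not consecutive in its
  list, so a cycle cut open at the head of its list becomes a linear order.\<close>

definition consec :: "'a list \<Rightarrow> 'a \<Rightarrow> 'a \<Rightarrow> bool" where
  "consec q a b \<longleftrightarrow> (\<exists>xs ys. q = xs @ a # b # ys)"

lemma consec_in: "consec q a b \<Longrightarrow> a \<in> set q \<and> b \<in> set q"
  by (auto simp: consec_def)

lemma consec_succ: "successively r q \<Longrightarrow> consec q a b \<Longrightarrow> r a b"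
  by (auto simp: consec_def successively_append_iff)

text \<open>Index of the first occurrence. It later serves as a rank: of two consecutive vertices
  the second is higher by one, and such ranks certify that the forced tree edges contain no
  cycle.\<close>

definition pos :: "'a list \<Rightarrow> 'a \<Rightarrow> nat" where
  "pos q v = length (takeWhile (\<lambda>x. x \<noteq> v) q)"

lemma pos_append: "v \<notin> set xs \<Longrightarrow> pos (xs @ v # ys) v = length xs"
  by (auto simp: pos_def takeWhile_append)

lemma consec_pos: "distinct q \<Longrightarrow> consec q a b \<Longrightarrow> pos q b = Suc (pos q a)"
proof -
  assume d: "distinct q" and "consec q a b"
  then obtain xs ys where q: "q = xs @ a # b # ys" by (auto simp: consec_def)
  have "pos (xs @ a # b # ys) a = length xs" using d q by (intro pos_append) auto
  moreover have "pos ((xs @ [a]) @ b # ys) b = length (xs @ [a])" using d q by (intro pos_append) auto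
  ultimately show ?thesis using q by simp
qed

lemma pos_inj: "v \<in> set q \<Longrightarrow> w \<in> set q \<Longrightarrow> pos q v = pos q w \<Longrightarrow> v = w"
proof -
  have "q ! pos q x = x" if "x \<in> set q" for x
    using that nth_length_takeWhile[of "\<lambda>y. y \<noteq> x" q] unfolding pos_def
    by (metis (mono_tags, lifting) length_takeWhile_le le_neq_implies_less takeWhile_eq_all_conv takeWhile_eq_take take_all_iff linorder_not_less)
  then show "v \<in> set q \<Longrightarrow> w \<in> set q \<Longrightarrow> pos q v = pos q w \<Longrightarrow> v = w" by metis
qed

lemma pos_less: "v \<in> set q \<Longrightarrow> pos q v < length q"
  unfolding pos_def by (metis (mono_tags, lifting) length_takeWhile_le le_neq_implies_less takeWhile_eq_all_conv takeWhile_eq_take take_all_iff linorder_not_less)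

lemma consec_pred_unique:
  assumes "distinct q" "consec q a c" "consec q b c" shows "a = b"
  using assms consec_pos[of q a c] consec_pos[of q b c] consec_in[of q a c] consec_in[of q b c] pos_inj[of a q b] by simp

lemma consec_succ_unique:
  assumes "distinct q" "consec q c a" "consec q c b" shows "a = b"
  using assms consec_pos[of q c a] consec_pos[of q c b] consec_in[of q c a] consec_in[of q c b] pos_inj[of a q b] by simp

lemma consec_hd: "distinct q \<Longrightarrow> consec q a b \<Longrightarrow> b \<noteq> hd q"
  by (auto simp: consec_def hd_append split: if_splits)

lemma consec_last: "distinct q \<Longrightarrow> consec q a b \<Longrightarrow> a \<noteq> last q"
  by (auto simp: consec_def last_append split: if_splits)

lemma ex_consec_next: "v \<in> set q \<Longrightarrow> v \<noteq> last q \<Longrightarrow> \<exists>w. consec q v w"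
  by (metis append.assoc append_Cons append_Nil consec_def last_snoc neq_Nil_conv split_list)

lemma ex_consec_prev: "v \<in> set q \<Longrightarrow> v \<noteq> hd q \<Longrightarrow> \<exists>w. consec q w v"
proof -
  assume "v \<in> set q" "v \<noteq> hd q"
  then obtain xs ys where q: "q = xs @ v # ys" "xs \<noteq> []" by (metis append_Nil list.sel(1) split_list)
  then have "q = butlast xs @ last xs # v # ys" by simp
  then show ?thesis unfolding consec_def by blast
qed

lemma consec_append: "consec ys a b \<Longrightarrow> consec (ys @ zs) a b"
  unfolding consec_def by (metis append_Cons append_assoc)

lemma consec_nth: "i + 1 < length W \<Longrightarrow> consec W (W ! i) (W ! (i + 1))"
  unfolding consec_def
  by (metis Cons_nth_drop_Suc Suc_eq_plus1 Suc_lessD id_take_nth_drop)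

lemma consec_next_prev_neq: "distinct q \<Longrightarrow> consec q a b \<Longrightarrow> consec q b c \<Longrightarrow> a \<noteq> c"
  using consec_pos[of q a b] consec_pos[of q b c] by auto

lemma not_successively_consec:
  "\<not> successively r p \<Longrightarrow> \<exists>a b. consec p a b \<and> \<not> r a b"
proof (induction p rule: induct_list012)
  case (3 x y zs)
  show ?case
  proof (cases "r x y")
    case True
    then obtain a b where ab: "consec (y # zs) a b" "\<not> r a b" using 3 by auto
    then have "consec (x # y # zs) a b" unfolding consec_def by (metis append_Cons)
    then show ?thesis using ab by blast
  next
    case False
    moreover have "consec (x # y # zs) x y" unfolding consec_def by (metis append_Nil)
    ultimately show ?thesis by blast
  qed
qed auto

text \<open>Rotation brings an offending edge into closing position. The other edges are then the
  consecutive pairs of the list, which stay a path when the offending edge is deleted.\<close>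

lemma cyc_bad_edge:
  assumes "cyc r p" "\<not> cyc r' p"
  obtains p' where "cyc r p'" "\<not> r' (last p') (hd p')"
proof (cases "r' (last p) (hd p)")
  case True
  then have "\<not> successively r' p" using assms by (auto simp: cyc_def)
  then obtain a b where ab: "consec p a b" "\<not> r' a b" using not_successively_consec by metis
  then obtain xs ys where "p = (xs @ [a]) @ b # ys" by (auto simp: consec_def)
  then have "cyc r ((b # ys) @ (xs @ [a]))" using cyc_rotate assms(1) by metis
  then show thesis using that[of "(b # ys) @ (xs @ [a])"] ab(2) by simp
qed (use that assms in blast)

lemma pos_hd: "p \<noteq> [] \<Longrightarrow> pos p (hd p) = 0"
  by (cases p) (auto simp: pos_def)

lemma pos_last: assumes "distinct p" "p \<noteq> []" shows "pos p (last p) = length p - 1"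
proof -
  have "last p \<notin> set (butlast p)"
    using assms by (metis append_butlast_last_id distinct_append distinct.simps(2) disjoint_iff list.set_intros(1))
  then show ?thesis using pos_append[of "last p" "butlast p" "[]"] assms(2) by simp
qed

text \<open>Length at least three is what matters: in a list of two vertices the closing edge would
  also be the consecutive one.\<close>

lemma cyc_no_short_edge:
  assumes "cyc r p" "consec p a b" shows "{a, b} \<noteq> {last p, hd p}"
proof
  assume eq: "{a, b} = {last p, hd p}"
  have d: "distinct p" "length p \<ge> 3" using assms(1) by (auto simp: cyc_def)
  have "b \<noteq> hd p" using consec_hd[OF d(1) assms(2)] .
  then have "b = last p" "a = hd p" using eq by (auto simp: doubleton_eq_iff)
  then have "pos p (last p) = Suc (pos p (hd p))" using consec_pos[OF d(1) assms(2)] by simp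
  moreover have "p \<noteq> []" using d(2) by auto
  ultimately show False using pos_hd[of p] pos_last[OF d(1)] d(2) by simp
qed

lemma last_take_Suc: "a < length W \<Longrightarrow> last (take (Suc a) W) = W ! a"
  by (simp add: take_Suc_conv_app_nth)

text \<open>The relation is a parameter so that the same facts serve for \<open>E\<close>,
  \<open>E - M\<close>, \<open>E - N0\<close> and the candidate trees. Every step needs both ends in
  \<open>S\<close>, but the empty walk exists at every vertex, so membership of the start is a
  separate hypothesis where it matters.\<close>

definition reach :: "('a \<Rightarrow> 'a \<Rightarrow> bool) \<Rightarrow> 'a set \<Rightarrow> 'a \<Rightarrow> 'a \<Rightarrow> bool" where
  "reach r S = (\<lambda>a b. a \<in> S \<and> b \<in> S \<and> r a b)\<^sup>*\<^sup>*"

lemma reach_refl [simp]: "reach r S a a"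
  by (simp add: reach_def)

lemma reach_trans: "reach r S a b \<Longrightarrow> reach r S b c \<Longrightarrow> reach r S a c"
  unfolding reach_def by simp

lemma reach_step: "a \<in> S \<Longrightarrow> b \<in> S \<Longrightarrow> r a b \<Longrightarrow> reach r S a b"
  unfolding reach_def by auto

lemma reach_sym:
  assumes "symp r" "reach r S a b" shows "reach r S b a"
  using assms(2) unfolding reach_def
  by (rule sympD[OF symp_rtranclp, rotated]) (use assms(1) in \<open>auto simp: symp_def\<close>)

lemma reach_mono:
  assumes "reach r S a b" "S \<subseteq> S'" "\<And>a b. a \<in> S \<Longrightarrow> b \<in> S \<Longrightarrow> r a b \<Longrightarrow> r' a b"
  shows "reach r' S' a b"
  using assms(1) unfolding reach_def
  by (rule rtranclp_mono[THEN predicate2D, rotated]) (use assms(2,3) in auto)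

lemma reach_closed:
  assumes "reach r S a b" "a \<in> K" "\<And>x y. x \<in> K \<Longrightarrow> x \<in> S \<Longrightarrow> y \<in> S \<Longrightarrow> r x y \<Longrightarrow> y \<in> K"
  shows "b \<in> K"
  using assms(1) unfolding reach_def
  by (induction rule: rtranclp_induct) (use assms(2,3) in auto)

lemma reach_in: "reach r S a b \<Longrightarrow> a \<in> S \<Longrightarrow> b \<in> S"
  by (rule reach_closed[of r S a b S]) auto

lemma reach_path:
  assumes "successively r p" "set p \<subseteq> S" "symp r" "a \<in> set p" "b \<in> set p"
  shows "reach r S a b"
proof -
  have "reach r S (hd p) v" if "v \<in> set p" for v
    using that assms(1,2)
  proof (induction p)
    case (Cons x xs)
    show ?case
    proof (cases "v = x")
      case False
      then have "xs \<noteq> []" using Cons by auto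
      then have "hd xs \<in> S" using Cons by auto
      then have "reach r S x (hd xs)"
        using Cons \<open>xs \<noteq> []\<close> by (intro reach_step) (auto simp: successively_Cons)
      moreover have "reach r S (hd xs) v"
        using Cons False by (auto simp: successively_Cons)
      ultimately have "reach r S x (hd xs)" "reach r S (hd xs) v" .
      then show ?thesis using reach_trans by fastforce
    qed auto
  qed auto
  then show ?thesis using reach_sym[OF assms(3)] reach_trans assms(4,5) by metis
qed

lemma reach_simple_path:
  assumes "reach r S a b" "a \<in> S"
  obtains p where "p \<noteq> []" "hd p = a" "last p = b" "distinct p" "successively r p" "set p \<subseteq> S"
proof -
  have "\<exists>p. p \<noteq> [] \<and> hd p = a \<and> last p = b \<and> distinct p \<and> successively r p \<and> set p \<subseteq> S"
    using assms(1) unfolding reach_def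
  proof (induction rule: rtranclp_induct)
    case base
    show ?case using assms(2) by (intro exI[of _ "[a]"]) auto
  next
    case (step b c)
    then obtain p where p: "p \<noteq> []" "hd p = a" "last p = b" "distinct p" "successively r p" "set p \<subseteq> S"
      by auto
    show ?case
    proof (cases "c \<in> set p")
      case True
      then obtain xs ys where "p = xs @ c # ys" by (meson split_list)
      then show ?thesis using p
        by (intro exI[of _ "xs @ [c]"]) (cases "xs = []"; auto simp: successively_append_iff)
    next
      case False
      then show ?thesis using p step
        by (intro exI[of _ "p @ [c]"]) (auto simp: successively_append_iff)
    qed
  qed
  then show thesis using that by blast
qed

section \<open>Nonseparating paths\<close>

text \<open>\<open>sep\<close> is 3-connectivity in the form in which small cuts arise below: a
  nonempty set \<open>Q\<close> whose neighbours lie in \<open>Q\<close> or among at most two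
  further vertices leaves no vertex over. With \<open>X\<close> empty it expresses
  connectedness.\<close>

locale cubic_matched =
  fixes V :: "'a set" and E M :: "'a set set"
  assumes fin: "finite V"
    and edge: "e \<in> E \<Longrightarrow> e \<subseteq> V \<and> card e = 2"
    and deg: "v \<in> V \<Longrightarrow> card {e \<in> E. v \<in> e} = 3"
    and sep: "\<lbrakk>X \<subseteq> V; card X < 3; Q \<subseteq> V; Q \<noteq> {}; Q \<inter> X = {};
               \<And>a b. a \<in> Q \<Longrightarrow> {a, b} \<in> E \<Longrightarrow> b \<in> Q \<union> X\<rbrakk> \<Longrightarrow> V \<subseteq> Q \<union> X"
    and M_sub: "M \<subseteq> E"
    and M_disj: "\<lbrakk>e \<in> M; f \<in> M; e \<noteq> f\<rbrakk> \<Longrightarrow> e \<inter> f = {}"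
    and M_cover: "v \<in> V \<Longrightarrow> \<exists>e\<in>M. v \<in> e"
begin

section \<open>Neighbours, mates and cycles of \<open>G - M\<close>\<close>

abbreviation adj :: "'a \<Rightarrow> 'a \<Rightarrow> bool" where "adj u v \<equiv> {u, v} \<in> E"

abbreviation cadj :: "'a \<Rightarrow> 'a \<Rightarrow> bool" where "cadj u v \<equiv> {u, v} \<in> E - M"

lemma adj_sym: "adj u v \<Longrightarrow> adj v u"
  by (simp add: insert_commute)

lemma symp_adj: "symp (\<lambda>u v. adj u v)"
  by (auto simp: symp_def insert_commute)

lemma symp_cadj: "symp (\<lambda>u v. cadj u v)"
  by (auto simp: symp_def insert_commute)

lemma adj_V: "adj u v \<Longrightarrow> u \<in> V \<and> v \<in> V"
  using edge by blast

lemma adj_neq: "adj u v \<Longrightarrow> u \<noteq> v"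
  using edge by fastforce

lemma edge_cases:
  assumes "e \<in> E" obtains u v where "e = {u, v}" "adj u v"
  using edge[OF assms] assms card_2_iff by metis

lemma inj_edge: "inj (\<lambda>w. {v, w})"
  by (rule injI) (metis doubleton_eq_iff)

lemma edges_at: "{e \<in> E. v \<in> e} = (\<lambda>w. {v, w}) ` {w. adj v w}"
proof
  show "{e \<in> E. v \<in> e} \<subseteq> (\<lambda>w. {v, w}) ` {w. adj v w}"
  proof
    fix e assume e: "e \<in> {e \<in> E. v \<in> e}"
    then obtain a b where ab: "e = {a, b}" "adj a b" by (auto elim: edge_cases)
    have "e = {v, a} \<or> e = {v, b}" using e ab(1) by auto
    then show "e \<in> (\<lambda>w. {v, w}) ` {w. adj v w}" using e by blast
  qed
qed auto

lemma card_nbs: "v \<in> V \<Longrightarrow> card {w. adj v w} = 3"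
  using deg[of v] card_image[OF inj_on_subset[OF inj_edge[of v]], of "{w. adj v w}"]
  by (simp add: edges_at)

lemma finite_nbs: "finite {w. adj v w}"
  by (rule finite_subset[OF _ fin]) (auto dest: adj_V)

lemma four_nbs: "adj v a \<Longrightarrow> adj v b \<Longrightarrow> adj v c \<Longrightarrow> adj v d \<Longrightarrow> distinct [a, b, c, d] \<Longrightarrow> False"
  using card_mono[OF finite_nbs[of v], of "{a, b, c, d}"] card_nbs[of v] adj_V by auto

lemma nbs_eq:
  assumes "adj v a" "adj v b" "adj v c" "distinct [a, b, c]"
  shows "{w. adj v w} = {a, b, c}"
  using assms four_nbs[of v a b c] by auto

definition mate :: "'a \<Rightarrow> 'a" where
  "mate v = (THE w. {v, w} \<in> M)"

lemma mate_unique: assumes "{v, w} \<in> M" shows "mate v = w"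
  unfolding mate_def
proof (rule the_equality)
  fix x assume "{v, x} \<in> M"
  then have "{v, x} = {v, w}" using M_disj[OF assms, of "{v, x}"] by auto
  then show "x = w" by (metis doubleton_eq_iff)
qed (rule assms)

lemma mate_M: assumes "v \<in> V" shows "{v, mate v} \<in> M"
proof -
  obtain e where "e \<in> M" "v \<in> e" using M_cover assms by blast
  then obtain w where "{v, w} \<in> M"
    using M_sub by (metis edge_cases insertE insert_commute singletonD subsetD)
  then show ?thesis using mate_unique by simp
qed

lemma adj_mate: "v \<in> V \<Longrightarrow> adj v (mate v)"
  using mate_M M_sub by blast

lemma mate_V: "v \<in> V \<Longrightarrow> mate v \<in> V"
  using adj_mate adj_V by blast

lemma mate_mate: "v \<in> V \<Longrightarrow> mate (mate v) = v"
  using mate_M[of v] mate_unique[of "mate v" v] by (simp add: insert_commute)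

lemma M_iff: "v \<in> V \<Longrightarrow> {v, w} \<in> M \<longleftrightarrow> w = mate v"
  using mate_unique mate_M by metis

lemma cyc_V: assumes "cyc cadj p" shows "set p \<subseteq> V"
proof
  fix v assume "v \<in> set p"
  then obtain q where "cyc cadj (v # q)" using cyc_start[OF assms] by metis
  then show "v \<in> V" using adj_V by (auto simp: cyc_Cons_iff)
qed

lemma cyc_nbs:
  assumes "cyc cadj (v # q)"
  shows "{w. adj v w} = {hd q, last q, mate v}" "distinct [hd q, last q, mate v]"
proof -
  have q: "length q \<ge> 2" "distinct q" "cadj v (hd q)" "cadj v (last q)"
    using assms by (auto simp: cyc_Cons_iff insert_commute)
  then have v: "v \<in> V" using adj_V by blast
  show d: "distinct [hd q, last q, mate v]"
    using hd_neq_last[OF q(2,1)] q mate_M[OF v] by auto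
  show "{w. adj v w} = {hd q, last q, mate v}"
    using nbs_eq[OF _ _ adj_mate[OF v] d] q by blast
qed

text \<open>The cycle uses both edges at \<open>r\<close> outside \<open>M\<close>, so only the
  matching edge can lead away from it.\<close>

lemma outside_nb:
  assumes "cyc cadj p" "r \<in> set p" "adj r x" "x \<notin> set p"
  shows "x = mate r"
proof -
  obtain q where q: "cyc cadj (r # q)" "set (r # q) = set p" using cyc_start assms by metis
  then have "q \<noteq> []" by (auto simp: cyc_def)
  moreover have "x \<in> {hd q, last q, mate r}" using cyc_nbs(1)[OF q(1)] assms(3) by blast
  moreover have "x \<notin> set q" using assms(4) q(2) by auto
  ultimately show ?thesis using hd_in_set last_in_set by blast
qed

section \<open>Optimal paths inside a vertex set\<close>

definition exits :: "'a set \<Rightarrow> 'a \<Rightarrow> bool" where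
  "exits U r \<longleftrightarrow> (\<exists>x. adj r x \<and> x \<notin> U)"

definition is_path :: "'a set \<Rightarrow> 'a \<Rightarrow> 'a list \<Rightarrow> 'a \<Rightarrow> bool" where
  "is_path U u W v \<longleftrightarrow> W \<noteq> [] \<and> hd W = u \<and> last W = v \<and> distinct W \<and> successively adj W \<and> set W \<subseteq> U"

text \<open>The vertices of \<open>U - W\<close> that can leave \<open>U\<close> while avoiding \<open>W\<close>; a path maximizing this set
  leaves no other vertices, since a component that cannot escape either allows a detour which
  frees a vertex of the path, or is cut off by two vertices of the path.\<close>

definition escaping :: "'a set \<Rightarrow> 'a list \<Rightarrow> 'a set" where
  "escaping U W = {w \<in> U - set W. \<exists>r \<in> U - set W. exits U r \<and> reach adj (U - set W) w r}"

lemma escaping_mono: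
  "set W' \<subseteq> set W \<Longrightarrow> escaping U W \<subseteq> escaping U W'"
  unfolding escaping_def by (fast intro: reach_mono)

text \<open>A chord is a shortcut whose vertices all lie on the old path, so no vertex stops
  escaping while the length drops. Length is the secondary criterion of \<open>best_path\<close> for
  this reason.\<close>

lemma shorten_path:
  assumes "is_path U u W v" "a + 1 < b" "b < length W" "adj (W ! a) (W ! b)"
  shows "is_path U u (take (a + 1) W @ drop b W) v"
    and "set (take (a + 1) W @ drop b W) \<subseteq> set W"
    and "length (take (a + 1) W @ drop b W) < length W"
proof -
  show "set (take (a + 1) W @ drop b W) \<subseteq> set W"
    using set_take_subset set_drop_subset by fastforce
  then show "is_path U u (take (a + 1) W @ drop b W) v"
    using assms unfolding is_path_def
    apply (intro conjI)
         apply auto[1]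
        apply (simp add: hd_append)
       apply (simp add: last_append)
    subgoal using set_take_disj_set_drop_if_distinct[of W "a+1" b] by simp
    subgoal
    proof -
      have "successively adj (take (a + 1) W @ drop (a + 1) W)" "successively adj (take b W @ drop b W)"
        using assms(1) by (simp_all add: is_path_def)
      then show ?thesis using assms(2-4)
        by (auto simp: successively_append_iff hd_drop_conv_nth last_take_Suc simp del: append_take_drop_id)
    qed
    subgoal by auto
    done
  show "length (take (a + 1) W @ drop b W) < length W" using assms by simp
qed

lemma detour_path:
  assumes "is_path U u W v" "a < b" "b < length W" "is_path (U - set W) x P y"
    "adj (W ! a) x" "adj y (W ! b)"
  shows "is_path U u (take (a + 1) W @ P @ drop b W) v"
proof -
  have "successively adj (take (a + 1) W @ drop (a + 1) W)" "successively adj (take b W @ drop b W)"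
    using assms(1) by (simp_all add: is_path_def)
  then have "successively adj (take (a + 1) W @ P @ drop b W)"
    using assms(2-6)
    by (auto simp: successively_append_iff hd_drop_conv_nth last_take_Suc is_path_def simp del: append_take_drop_id)
  moreover have "distinct (take (a + 1) W @ P @ drop b W)"
    using assms set_take_disj_set_drop_if_distinct[of W "a+1" b] set_take_subset[of "a+1" W] set_drop_subset[of b W]
    by (auto simp: is_path_def)
  moreover have "set (take (a + 1) W @ P @ drop b W) \<subseteq> U"
    using assms set_take_subset[of "a+1" W] set_drop_subset[of b W]
    by (auto simp: is_path_def)
  ultimately show ?thesis using assms by (simp add: is_path_def hd_append last_append)
qed

text \<open>Lexicographic optimum, first many escaping vertices and then few path vertices, packed
  into one number in base \<open>N\<close>. As \<open>N\<close> exceeds the length of every path and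
  paths are nonempty, the second digit stays below \<open>N\<close>.\<close>

lemma best_path:
  assumes "U \<subseteq> V" "is_path U u W0 v"
  obtains W where "is_path U u W v"
    "\<And>W'. is_path U u W' v \<Longrightarrow> card (escaping U W') \<le> card (escaping U W)"
    "\<And>W'. is_path U u W' v \<Longrightarrow> escaping U W \<subseteq> escaping U W' \<Longrightarrow> length W \<le> length W'"
proof -
  define N where "N = Suc (card V)"
  define f where "f W = card (escaping U W) * N + (N - length W)" for W
  have finU: "finite U" using fin assms(1) finite_subset by blast
  have esc: "finite (escaping U W)" "card (escaping U W) \<le> card V" for W
    using finU fin assms(1) by (auto simp: escaping_def intro!: card_mono)
  have len: "length W < N" if "is_path U u W v" for W
    using that assms(1) fin by (auto simp: is_path_def N_def distinct_card[symmetric] less_Suc_eq_le intro!: card_mono)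
  have "f W < Suc (card V * N + N)" for W
    using add_mono[OF mult_le_mono1[OF esc(2)[of W], of N], of "N - length W" N] by (simp add: f_def)
  then obtain W where W: "is_path U u W v" "\<And>W'. is_path U u W' v \<Longrightarrow> f W' \<le> f W"
    using ex_has_greatest_nat[of "\<lambda>W. is_path U u W v" W0 f] assms(2) by blast
  have 1: "card (escaping U W') \<le> card (escaping U W)" if "is_path U u W' v" for W'
  proof (rule ccontr)
    assume "\<not> ?thesis"
    then have "Suc (card (escaping U W)) * N \<le> card (escaping U W') * N" by (intro mult_le_mono1) simp
    moreover have "length W > 0" using W(1) by (auto simp: is_path_def)
    then have "N - length W < N" using len[OF W(1)] by simp
    ultimately have "f W < f W'" unfolding f_def by simp
    then show False using W(2)[OF that] by simp
  qed
  show thesis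
  proof (rule that[OF W(1) 1])
    fix W' assume W': "is_path U u W' v" "escaping U W \<subseteq> escaping U W'"
    then have "card (escaping U W) * N \<le> card (escaping U W') * N"
      using card_mono[OF esc(1)] by simp
    then show "length W \<le> length W'"
      using W(2)[OF W'(1)] len[OF W(1)] len[OF W'(1)] unfolding f_def by linarith
  qed simp
qed

text \<open>The length criterion excludes chords; the count of escaping vertices excludes captive
  components. A captive component yields a set \<open>Q\<close> bounded by two path vertices
  \<open>X\<close>, and the vertices outside \<open>U\<close> are those that \<open>X\<close> would
  separate from \<open>Q\<close>.\<close>

lemma nonseparating_path:
  assumes U: "U \<subseteq> V" "V - U \<noteq> {}" and W0: "is_path U u W0 v"
  obtains W where "is_path U u W v"
    "\<And>a b. a \<in> set W \<Longrightarrow> b \<in> set W \<Longrightarrow> adj a b \<Longrightarrow> consec W a b \<or> consec W b a"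
    "U - set W \<subseteq> escaping U W"
proof -
  obtain W where W: "is_path U u W v"
    and max: "\<And>W'. is_path U u W' v \<Longrightarrow> card (escaping U W') \<le> card (escaping U W)"
    and min: "\<And>W'. is_path U u W' v \<Longrightarrow> escaping U W \<subseteq> escaping U W' \<Longrightarrow> length W \<le> length W'"
    using best_path[OF U(1) W0] by metis
  define B where "B = escaping U W"
  define S where "S = U - set W"
  have WU: "set W \<subseteq> U" and dW: "distinct W" "W \<noteq> []" using W by (auto simp: is_path_def)
  have finU: "finite U" using fin U(1) finite_subset by blast
  have nochord: False if "a + 1 < b" "b < length W" "adj (W ! a) (W ! b)" for a b
    using shorten_path(3)[OF W that]
      min[OF shorten_path(1)[OF W that] escaping_mono[OF shorten_path(2)[OF W that]]] by linarith
  have ind: "a = b + 1 \<or> b = a + 1" if "a < length W" "b < length W" "adj (W ! a) (W ! b)" for a b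
    using that nochord[of a b] nochord[of b a] adj_sym[OF that(3)] adj_neq[OF that(3)]
    by (metis Suc_eq_plus1 linorder_neqE_nat not_less_eq less_antisym)
  \<comment> \<open>A good position carries a path vertex that would escape if a detour freed
    it.\<close>
  define good where "good g \<longleftrightarrow> g < length W \<and> (exits U (W ! g) \<or> (\<exists>w\<in>B. adj (W ! g) w))" for g
  define comp where "comp w = {x. reach adj S w x}" for w
  define att where "att w = {a. a < length W \<and> (\<exists>x\<in>comp w. adj (W ! a) x)}" for w
  have comp_in: "comp w \<subseteq> S" if "w \<in> S" for w
    using that reach_in by (fastforce simp: comp_def)
  have B_iff: "x \<in> B \<longleftrightarrow> x \<in> S \<and> (\<exists>r\<in>S. exits U r \<and> reach adj S x r)" for x
    by (simp add: B_def escaping_def S_def)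
  have BS: "B \<subseteq> S" using B_iff by blast
  have comp_B: "x \<notin> B" if w: "w \<in> S - B" and x: "x \<in> comp w" for w x
  proof
    assume "x \<in> B"
    then obtain r where r: "r \<in> S" "exits U r" "reach adj S x r" using B_iff by blast
    have "reach adj S w r" using reach_trans[OF _ r(3)] x by (simp add: comp_def)
    then show False using w r B_iff by blast
  qed
  have comp_exit: "\<not> exits U x" if w: "w \<in> S - B" and x: "x \<in> comp w" for w x
  proof
    assume "exits U x"
    moreover have "x \<in> S" using comp_in[of w] w x by auto
    ultimately have "x \<in> B" unfolding B_iff using reach_refl[of adj S x] by auto
    then show False using comp_B[OF w x] by simp
  qed
  \<comment> \<open>A captive component attached on both sides of a good position offers a detour
    around it, which frees an additional escaping vertex and contradicts maximality.\<close>
  have no_straddle: False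
    if w: "w \<in> S - B" and ab: "a \<in> att w" "b \<in> att w" and g: "good g" "a < g" "g < b" for w a b g
  proof -
    obtain x y where xy: "x \<in> comp w" "y \<in> comp w" "adj (W ! a) x" "adj (W ! b) y"
      using ab by (auto simp: att_def)
    have "reach adj S x y"
      using xy(1,2) reach_trans[OF reach_sym[OF symp_adj, of S w x], of y] unfolding comp_def by simp
    moreover have xS: "x \<in> S" using xy comp_in w by auto
    \<comment> \<open>Connection inside the component, not merely inside \<open>S\<close>: the
      detour then avoids \<open>B\<close> and blocks none of the existing escapes.\<close>
    ultimately have "reach adj (comp w) x y"
    proof -
      assume xy': "reach adj S x y"
      show "reach adj (comp w) x y"
        using xy' unfolding reach_def
      proof (induction rule: rtranclp_induct)
        case (step c d)
        have "reach adj S w c" using reach_trans[of adj S w x c] xy(1) step(1)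
          by (simp add: comp_def reach_def)
        moreover have "reach adj S w d"
          using reach_trans[OF calculation reach_step[of c S d]] step(2) by simp
        ultimately show ?case using step
          by (intro rtranclp.rtrancl_into_rtrancl[OF step(3)]) (simp add: comp_def)
      qed simp
    qed
    then obtain P where P: "P \<noteq> []" "hd P = x" "last P = y" "distinct P" "successively adj P" "set P \<subseteq> comp w"
      using reach_simple_path xy(1) by metis
    have b: "b < length W" using ab by (auto simp: att_def)
    have PS: "set P \<subseteq> U - set W" using P(6) comp_in[of w] w by (auto simp: S_def)
    define W' where "W' = take (a + 1) W @ P @ drop b W"
    have W': "is_path U u W' v" unfolding W'_def
      using detour_path[OF W, of a b x P y] g b xy P PS adj_sym by (auto simp: is_path_def)
    have gW: "W ! g \<in> set W" using g(1) by (simp add: good_def)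
    have gW': "W ! g \<notin> set W'"
    proof -
      have "W ! g \<notin> set (take (a + 1) W)" "W ! g \<notin> set (drop b W)"
        using g b dW(1) by (auto simp: in_set_conv_nth nth_eq_iff_index_eq good_def)
      then show ?thesis using PS gW by (auto simp: W'_def)
    qed
    have BW': "B \<inter> set W' = {}"
      using comp_B[OF w] P(6) set_take_subset[of "a+1" W] set_drop_subset[of b W] BS
      by (auto simp: W'_def S_def)
    have Besc: "B \<subseteq> escaping U W'"
    proof
      fix c assume c: "c \<in> B"
      then obtain r where r: "r \<in> S" "exits U r" "reach adj S c r" using B_iff by blast
      have "reach adj (U - set W') c r" using r(3) unfolding reach_def
      proof (induction rule: converse_rtranclp_induct)
        case (step d e)
        then have "d \<in> B" "e \<in> B" using r
          by (auto simp: B_iff reach_def intro: converse_rtranclp_into_rtranclp)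
        then show ?case using step BW' BS
          by (intro converse_rtranclp_into_rtranclp[of _ d e]) (auto simp: S_def)
      qed auto
      moreover have "r \<in> B" unfolding B_iff using r(1,2) reach_refl[of adj S r] by auto
      ultimately show "c \<in> escaping U W'" using r(2) BW' BS c
        unfolding escaping_def S_def by blast
    qed
    have "W ! g \<in> escaping U W'"
    proof (cases "exits U (W ! g)")
      case True
      then show ?thesis using gW gW' WU by (auto simp: escaping_def intro!: bexI[of _ "W ! g"])
    next
      case False
      then obtain w' where w': "w' \<in> B" "adj (W ! g) w'" using g(1) by (auto simp: good_def)
      then obtain r where r: "r \<in> U - set W'" "exits U r" "reach adj (U - set W') w' r" "w' \<in> U - set W'"
        using Besc by (auto simp: escaping_def)
      have gU: "W ! g \<in> U - set W'" using gW gW' WU by auto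
      have "reach adj (U - set W') (W ! g) r"
        using reach_trans[OF reach_step[OF gU r(4)] r(3)] w'(2) by simp
      then show ?thesis using gU r(1,2) unfolding escaping_def by auto
    qed
    moreover have "W ! g \<notin> B" using gW BS by (auto simp: S_def)
    ultimately have "B \<subset> escaping U W'" using Besc by auto
    then have "card B < card (escaping U W')"
      using finU by (intro psubset_card_mono) (auto simp: escaping_def)
    then show False using max[OF W'] by (simp add: B_def)
  qed
  have "S \<subseteq> B"
  proof (rule ccontr)
    assume "\<not> S \<subseteq> B"
    then obtain w0 where w0: "w0 \<in> S - B" by blast
    have Wnb: "\<exists>g<length W. x = W ! g" if "x \<in> set W" for x using that by (auto simp: in_set_conv_nth)
    have comp_nb: "b \<in> comp w \<or> (\<exists>g\<in>att w. b = W ! g)" if "w \<in> S - B" "a \<in> comp w" "adj a b" for w a b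
    proof -
      have "b \<in> U" using comp_exit[OF that(1,2)] that(3) by (auto simp: exits_def)
      show ?thesis
      proof (cases "b \<in> set W")
        case True
        then show ?thesis using that Wnb[OF True] adj_sym by (auto simp: att_def)
      next
        case False
        then have "reach adj S a b" using \<open>b \<in> U\<close> that comp_in[of w] by (intro reach_step) (auto simp: S_def)
        then show ?thesis using that(2) reach_trans by (auto simp: comp_def)
      qed
    qed
    have self: "w \<in> comp w" for w by (simp add: comp_def)
    have c0: "comp w0 \<subseteq> U" using comp_in[of w0] w0 by (auto simp: S_def)
    \<comment> \<open>An unattached captive component would be closed under adjacency, against
      connectedness.\<close>
    have "att w0 \<noteq> {}"
    proof
      assume "att w0 = {}"
      then have "V \<subseteq> comp w0 \<union> {}"
        using self[of w0] c0 U(1) comp_nb[OF w0] by (intro sep) auto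
      then show False using U c0 by auto
    qed
    define a0 where "a0 = Min (att w0)"
    define b0 where "b0 = Max (att w0)"
    have "finite (att w0)" by (auto simp: att_def)
    then have ab0: "a0 \<in> att w0" "b0 \<in> att w0" "\<And>g. g \<in> att w0 \<Longrightarrow> a0 \<le> g \<and> g \<le> b0"
      using \<open>att w0 \<noteq> {}\<close> by (auto simp: a0_def b0_def)
    \<comment> \<open>The nearest good positions around all attachments of the component. An end of
      the path is the fallback; it is a safe boundary even when it is not good, since no position
      lies beyond it.\<close>
    define w1 where "w1 = (GREATEST g. g \<le> a0 \<and> (g = 0 \<or> good g))"
    define w2 where "w2 = (LEAST g. b0 \<le> g \<and> (g = length W - 1 \<or> good g))"
    have w1: "w1 \<le> a0" "w1 = 0 \<or> good w1"
      using GreatestI_nat[of "\<lambda>g. g \<le> a0 \<and> (g = 0 \<or> good g)" 0 a0] by (auto simp: w1_def)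
    have w1': "g \<le> w1" if "g \<le> a0" "good g" for g
      using Greatest_le_nat[of "\<lambda>g. g \<le> a0 \<and> (g = 0 \<or> good g)" g a0] that by (auto simp: w1_def)
    have b0len: "b0 \<le> length W - 1" using ab0(2) by (auto simp: att_def)
    have w2: "b0 \<le> w2" "w2 = length W - 1 \<or> good w2"
      using LeastI[of "\<lambda>g. b0 \<le> g \<and> (g = length W - 1 \<or> good g)" "length W - 1"] b0len by (auto simp: w2_def)
    have w2': "w2 \<le> g" if "b0 \<le> g" "good g" for g
      using Least_le[of "\<lambda>g. b0 \<le> g \<and> (g = length W - 1 \<or> good g)" g] that by (auto simp: w2_def)
    have lt: "w1 < length W" "w2 < length W" "w1 \<le> w2"
      using w1 w2 dW b0len ab0 by (auto simp: good_def att_def intro: order.trans)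
    have notgood: "\<not> good g" if "w1 < g" "g < w2" for g
    proof
      assume "good g"
      then show False
        using that w1'[of g] w2'[of g] no_straddle[OF w0 ab0(1,2), of g] by linarith
    qed
    \<comment> \<open>A captive component touching the open segment cannot reach beyond it, as it
      would straddle \<open>w1\<close> or \<open>w2\<close>.\<close>
    have inside: "att w \<subseteq> {w1..w2}" if "w \<in> S - B" "g \<in> att w" "w1 < g" "g < w2" for w g
    proof
      fix b assume b: "b \<in> att w"
      have "\<not> b < w1" using no_straddle[OF that(1) b that(2), of w1] w1(2) that by auto
      moreover have "\<not> w2 < b" using no_straddle[OF that(1,2) b, of w2] w2(2) that b by (auto simp: att_def)
      ultimately show "b \<in> {w1..w2}" by auto
    qed
    have comp_eq: "comp x = comp w" if "x \<in> comp w" for x w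
      using that reach_trans[of adj S w x] reach_trans[of adj S x w] reach_sym[OF symp_adj, of S w x]
      by (auto simp: comp_def)
    \<comment> \<open>The open segment together with every captive component attached only to the
      closed segment. No position in the open segment is good, so edges leave this set only towards
      the two boundary vertices.\<close>
    define Q where "Q = {W ! g | g. w1 < g \<and> g < w2} \<union> {w \<in> S - B. att w \<subseteq> {w1..w2}}"
    define X where "X = {W ! w1, W ! w2}"
    have XW: "X \<subseteq> set W" using lt by (auto simp: X_def)
    have "w0 \<in> Q" using w0 ab0(3) w1(1) w2(1) by (fastforce simp: Q_def)
    have "Q \<subseteq> U" using lt WU by (auto simp: Q_def S_def)
    have QX: "Q \<inter> X = {}"
      using lt dW XW by (auto simp: Q_def X_def S_def nth_eq_iff_index_eq)
    have range: "W ! g \<in> Q \<union> X" if "w1 \<le> g" "g \<le> w2" for g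
      using that by (cases "g = w1"; cases "g = w2") (auto simp: Q_def X_def)
    have closed: "b \<in> Q \<union> X" if aQ: "a \<in> Q" and ab: "adj a b" for a b
    proof (cases "a \<in> S")
      case True
      then have a: "a \<in> S - B" "att a \<subseteq> {w1..w2}" using aQ lt by (auto simp: Q_def S_def)
      then consider "b \<in> comp a" | g where "g \<in> att a" "b = W ! g" using comp_nb[OF a(1) self ab] by blast
      then show ?thesis
      proof cases
        case 1
        then have "b \<in> S - B" using comp_in[of a] comp_B[of a b] a by auto
        moreover have "att b = att a" using comp_eq[OF 1] by (simp add: att_def)
        ultimately show ?thesis using a by (simp add: Q_def)
      next
        case 2
        then have "w1 \<le> g" "g \<le> w2" using a(2) by auto
        then show ?thesis using range 2(2) by simp
      qed
    next
      case False
      then obtain g where g: "a = W ! g" "w1 < g" "g < w2" using aQ by (auto simp: Q_def)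
      have ng: "\<not> good g" using notgood g by simp
      then have "b \<in> U" using ab g lt by (auto simp: good_def exits_def)
      show ?thesis
      proof (cases "b \<in> set W")
        case True
        then obtain h where h: "h < length W" "b = W ! h" using Wnb by auto
        then have "g = h + 1 \<or> h = g + 1" using ind[of g h] ab g lt by auto
        then have "w1 \<le> h" "h \<le> w2" using g by auto
        then show ?thesis using h(2) range by simp
      next
        case False
        then have b: "b \<in> S - B" using \<open>b \<in> U\<close> ng ab g lt by (auto simp: S_def good_def)
        have "g < length W" using g lt by simp
        then have "g \<in> att b" using ab g(1) self[of b] by (auto simp: att_def)
        then show ?thesis using inside[OF b _ g(2,3)] b by (simp add: Q_def)
      qed
    qed
    have "V \<subseteq> Q \<union> X"
    proof (rule sep)
      show "card X < 3" by (simp add: X_def card_insert_if)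
      show "X \<subseteq> V" "Q \<subseteq> V" using XW WU U \<open>Q \<subseteq> U\<close> by auto
      show "Q \<noteq> {}" using \<open>w0 \<in> Q\<close> by auto
    qed (fact QX closed)+
    then have "V \<subseteq> U" using \<open>Q \<subseteq> U\<close> XW WU by blast
    then show False using U(2) by simp
  qed
  then have 1: "U - set W \<subseteq> escaping U W" unfolding S_def B_def .
  have 2: "consec W a b \<or> consec W b a" if ab: "a \<in> set W" "b \<in> set W" "adj a b" for a b
  proof -
    obtain i j where ij: "i < length W" "j < length W" "a = W ! i" "b = W ! j"
      using ab(1,2) by (auto simp: in_set_conv_nth)
    then have "i = j + 1 \<or> j = i + 1" using ind ab(3) by simp
    then show ?thesis using ij consec_nth[of i W] consec_nth[of j W] by auto
  qed
  show thesis by (rule that[OF W 2 1])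
qed

section \<open>Induced cycles and Hamiltonian paths\<close>

text \<open>With \<open>R\<close> the set of vertices of an outer cycle \<open>U\<close> that are still joined to the centre, this says
  that every component left by removing \<open>D\<close> from \<open>U\<close> can be attached to the tree.\<close>

definition rest_reaches :: "'a set \<Rightarrow> 'a set \<Rightarrow> 'a set \<Rightarrow> bool" where
  "rest_reaches U R D \<longleftrightarrow> (\<forall>w \<in> U - D. \<exists>r \<in> R - D. reach adj (U - D) w r)"

text \<open>The chord closes up the side \<open>xs\<close> and releases the side \<open>ys\<close>.
  The released vertices form a path, so one vertex \<open>d\<close> with a neighbour off the cycle
  rescues all of them: that neighbour reaches \<open>R\<close>, or it lies outside \<open>U\<close>
  and \<open>d\<close> itself is in \<open>R\<close>.\<close>

lemma chord_step:
  assumes p: "cyc adj (a # xs @ b # ys)" "set (a # xs @ b # ys) \<subseteq> U" "xs \<noteq> []" "adj a b"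
    and ok: "rest_reaches U R (set (a # xs @ b # ys))"
    and d: "d \<in> set ys" "adj d x" "x \<notin> set (a # xs @ b # ys)" "x \<notin> U \<Longrightarrow> d \<in> R"
    and R: "R \<subseteq> U"
  shows "cyc adj (a # xs @ [b])" "rest_reaches U R (set (a # xs @ [b]))"
proof -
  define D where "D = set (a # xs @ b # ys)"
  define D' where "D' = set (a # xs @ [b])"
  have dist: "distinct (a # xs @ b # ys)" and suc: "successively adj (a # xs @ b # ys)"
    using p(1) by (auto simp: cyc_def)
  show "cyc adj (a # xs @ [b])"
    using p(3,4) dist suc adj_sym[OF p(4)] unfolding cyc_def
    by (cases xs) (auto simp: successively_append_iff successively_Cons hd_append split: if_splits)
  have D': "D' \<subseteq> D" "set ys \<subseteq> U - D'" "D' \<subseteq> U" using dist p(2) by (auto simp: D_def D'_def)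
  have old: "\<exists>r \<in> R - D'. reach adj (U - D') w r" if w: "w \<in> U - D" for w
  proof -
    obtain r where r: "r \<in> R - D" "reach adj (U - D) w r"
      using ok w unfolding rest_reaches_def D_def[symmetric] by auto
    then have "reach adj (U - D') w r" using D'(1) by (intro reach_mono[OF r(2)]) auto
    then show ?thesis using r(1) D'(1) by auto
  qed
  have dr: "\<exists>r \<in> R - D'. reach adj (U - D') d r"
  proof (cases "x \<in> U")
    case True
    then have "x \<in> U - D" using d(3) by (simp add: D_def)
    then obtain r where r: "r \<in> R - D'" "reach adj (U - D') x r" using old by auto
    have "reach adj (U - D') d x"
      using \<open>x \<in> U - D\<close> D'(1,2) d(1,2) by (intro reach_step) auto
    then show ?thesis using r(1) reach_trans[OF _ r(2)] by auto
  next
    case False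
    then have "d \<in> R - D'" using d D'(2) by auto
    then show ?thesis by (intro bexI[of _ d]) auto
  qed
  have "\<exists>r \<in> R - D'. reach adj (U - D') w r" if "w \<in> U - D'" for w
  proof (cases "w \<in> D")
    case True
    then have w: "w \<in> set ys" using that by (auto simp: D_def D'_def)
    have "reach adj (U - D') w d"
      using suc by (intro reach_path[OF _ D'(2) symp_adj w d(1)]) (auto simp: successively_append_iff successively_Cons)
    then show ?thesis using dr reach_trans[of adj "U - D'" w d] by auto
  qed (use old that in auto)
  then show "rest_reaches U R (set (a # xs @ [b]))" unfolding rest_reaches_def D'_def[symmetric] by auto
qed

text \<open>Cutting along chords shortens the cycle until none is left. The result is given as a
  vertex set with all inner degrees two, because the 2-regular graph is later taken to be induced by
  its vertices.\<close>

lemma induced_cycle: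
  assumes "cyc adj p" "set p \<subseteq> U" "U \<subseteq> V" "V - U \<noteq> {}" "rest_reaches U R (set p)" "R \<subseteq> U"
    "\<And>d. d \<in> set p \<Longrightarrow> exits U d \<Longrightarrow> d \<in> R"
  shows "\<exists>D \<subseteq> set p. D \<noteq> {} \<and> (\<forall>a\<in>D. card {b \<in> D. adj a b} = 2) \<and> rest_reaches U R D"
  using assms
proof (induction "length p" arbitrary: p rule: less_induct)
  case less
  show ?case
  proof (cases "\<forall>a \<in> set p. card {b \<in> set p. adj a b} = 2")
    case True
    moreover have "set p \<noteq> {}" using less.prems(1) by (auto simp: cyc_def)
    ultimately show ?thesis using less.prems(5) by blast
  next
    case False
    then obtain a where a: "a \<in> set p" "card {b \<in> set p. adj a b} \<noteq> 2" by blast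
    obtain q where q: "cyc adj (a # q)" "set (a # q) = set p" using cyc_start[OF less.prems(1) a(1)] by metis
    have len: "length (a # q) = length p"
      using q less.prems(1) distinct_card[of p] distinct_card[of "a # q"] unfolding cyc_def by metis
    have q2: "length q \<ge> 2" "distinct (a # q)" "adj a (hd q)" "adj a (last q)"
      using q(1) adj_sym[of "last q" a] by (auto simp: cyc_Cons_iff)
    have hl: "hd q \<noteq> last q" "q \<noteq> []" using hd_neq_last q2 by auto
    have "\<exists>b. b \<in> set p \<and> adj a b \<and> b \<noteq> hd q \<and> b \<noteq> last q"
    proof (rule ccontr)
      assume "\<not> ?thesis"
      then have "{b \<in> set p. adj a b} = {hd q, last q}" using q2 hl q(2) by auto
      then show False using a(2) hl by simp
    qed
    then obtain b where b: "b \<in> set p" "adj a b" "b \<noteq> hd q" "b \<noteq> last q" by blast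
    have "b \<in> set q" using b q adj_neq[OF b(2)] by auto
    then obtain xs ys where xy: "q = xs @ b # ys" by (meson split_list)
    have ne: "xs \<noteq> []" "ys \<noteq> []" using b xy by (auto simp: hd_append last_append)
    have cy: "cyc adj (a # xs @ b # ys)" "cyc adj (b # ys @ a # xs)"
      using q xy cyc_rotate[of adj "a # xs" "b # ys"] by auto
    have st: "set (a # xs @ b # ys) = set p" "set (b # ys @ a # xs) = set p" using q xy by auto
    have suc: "successively adj (a # xs @ b # ys)" "distinct (a # xs @ b # ys)" "adj (last ys) a"
      using cy(1) ne by (auto simp: cyc_def)
    have "adj a (hd xs)" "adj (last xs) b" "adj b (hd ys)"
      using suc ne by (auto simp: successively_append_iff successively_Cons)
    moreover have "hd xs \<in> set xs" "last xs \<in> set xs" "hd ys \<in> set ys" "last ys \<in> set ys" using ne by auto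
    moreover have "distinct [hd xs, last ys, b]" "distinct [last xs, hd ys, a]"
      using calculation(4-7) suc(2) by auto
    ultimately have nbs: "{w. adj a w} = {hd xs, last ys, b}" "{w. adj b w} = {last xs, hd ys, a}"
      using nbs_eq[of a "hd xs" "last ys" b] nbs_eq[of b "last xs" "hd ys" a] suc(3) b(2)
      by (auto dest: adj_sym)
    \<comment> \<open>Otherwise the cycle would be closed under adjacency and connectedness would
      leave nothing outside \<open>U\<close>.\<close>
    have "\<exists>d \<in> set p. \<exists>x. adj d x \<and> x \<notin> set p"
    proof (rule ccontr)
      assume *: "\<not> ?thesis"
      have "V \<subseteq> set p \<union> {}"
        by (rule sep) (use * less.prems(2,3) a in auto)
      then show False using less.prems(2,4) by blast
    qed
    then obtain d x where d: "d \<in> set p" "adj d x" "x \<notin> set p" by blast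
    have sub: "{hd xs, last ys, b} \<subseteq> set p" "{last xs, hd ys, a} \<subseteq> set p"
      unfolding st(1)[symmetric] using ne by auto
    have "x \<in> {w. adj d w}" using d(2) by simp
    \<comment> \<open>Both ends of the chord have all three neighbours on the cycle, so
      \<open>d\<close> lies strictly on one side; that side is released and the other kept.\<close>
    then have "d \<noteq> a" "d \<noteq> b" using d(3) sub nbs by (metis subsetD)+
    then have "d \<in> set ys \<or> d \<in> set xs" using d(1) st(1) by auto
    moreover have inU: "set (a # xs @ b # ys) \<subseteq> U" "set (b # ys @ a # xs) \<subseteq> U"
      and ok: "rest_reaches U R (set (a # xs @ b # ys))" "rest_reaches U R (set (b # ys @ a # xs))"
      and xnot: "x \<notin> set (a # xs @ b # ys)" "x \<notin> set (b # ys @ a # xs)"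
      unfolding st by (rule less.prems(2) less.prems(5) d(3))+
    moreover have dR: "x \<notin> U \<Longrightarrow> d \<in> R" using less.prems(7)[OF d(1)] d(2) by (auto simp: exits_def)
    moreover have lt: "length (a # xs @ [b]) < length p" "length (b # ys @ [a]) < length p"
      unfolding len[symmetric] xy using ne[folded length_greater_0_conv] by simp_all
    ultimately have "\<exists>p'. cyc adj p' \<and> rest_reaches U R (set p') \<and> set p' \<subseteq> set p \<and> length p' < length p"
    proof (elim disjE)
      assume "d \<in> set ys"
      then have "cyc adj (a # xs @ [b])" "rest_reaches U R (set (a # xs @ [b]))"
        using chord_step[OF cy(1) inU(1) ne(1) b(2) ok(1) _ d(2) xnot(1) dR less.prems(6)] by simp_all
      then show ?thesis using st(1) lt(1) by (intro exI[of _ "a # xs @ [b]"]) auto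
    next
      assume "d \<in> set xs"
      then have "cyc adj (b # ys @ [a])" "rest_reaches U R (set (b # ys @ [a]))"
        using chord_step[OF cy(2) inU(2) ne(2) adj_sym[OF b(2)] ok(2) _ d(2) xnot(2) dR less.prems(6)] by simp_all
      then show ?thesis using st(1) lt(2) by (intro exI[of _ "b # ys @ [a]"]) auto
    qed
    then obtain p' where p': "cyc adj p'" "rest_reaches U R (set p')" "set p' \<subseteq> set p" "length p' < length p" by blast
    have "\<exists>D \<subseteq> set p'. D \<noteq> {} \<and> (\<forall>a\<in>D. card {b \<in> D. adj a b} = 2) \<and> rest_reaches U R D"
      using less.hyps[OF p'(4,1) _ less.prems(3,4) p'(2) less.prems(6)] p'(3) less.prems(2,7) by blast
    then show ?thesis using p'(3) by (meson order_trans)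
  qed
qed

section \<open>Hamiltonian path or avoiding cycle\<close>

lemma exits_nbs:
  assumes "exits U v" "adj v a" "adj v b" "adj v c" "{a, b, c} \<subseteq> U" "distinct [a, b, c]"
  shows False
proof -
  obtain x where "adj v x" "x \<notin> U" using assms(1) by (auto simp: exits_def)
  then show False using four_nbs[of v a b c x] assms(2-6) by auto
qed

lemma third_nb:
  assumes "v \<in> V" "\<not> exits U v"
  obtains m where "adj v m" "m \<in> U" "m \<noteq> a" "m \<noteq> b"
proof -
  have "\<not> {w. adj v w} \<subseteq> {a, b}"
  proof
    assume "{w. adj v w} \<subseteq> {a, b}"
    then have "card {w. adj v w} \<le> card {a, b}" by (intro card_mono) auto
    then show False using card_nbs[OF assms(1)]
      by (simp add: card_insert_if split: if_splits)
  qed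
  then show thesis using that assms(2) by (auto simp: exits_def)
qed

text \<open>A spanning path \<open>ys\<close> from \<open>s\<close> that runs into a cycle \<open>ds\<close>. In a shortest such cycle the third
  neighbour of a vertex next to the entry point lies on the path.\<close>

definition lollipop :: "'a set \<Rightarrow> 'a \<Rightarrow> 'a list \<Rightarrow> 'a list \<Rightarrow> bool" where
  "lollipop U s ys ds \<longleftrightarrow> cyc adj ds \<and> distinct (ys @ ds) \<and> set (ys @ ds) = U \<and>
     successively adj (ys @ ds) \<and> hd (ys @ ds) = s"

text \<open>Reversing the cycle except for its entry point exchanges the two neighbours of the entry
  point, so whatever is shown for one of them holds for the other.\<close>

lemma lollipop_mirror:
  assumes "lollipop U s ys (e # zs)" shows "lollipop U s ys (e # rev zs)"
proof -
  have c: "cyc adj (e # zs)" "successively adj ys" "ys \<noteq> [] \<Longrightarrow> adj (last ys) e"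
    using assms by (auto simp: lollipop_def successively_append_iff)
  have "cyc adj (rev (e # zs))" by (rule cyc_rev[OF symp_adj c(1)])
  then have r: "cyc adj (e # rev zs)" using cyc_rotate[of adj "rev zs" "[e]"] by simp
  then have "successively adj (e # rev zs)" by (simp add: cyc_def)
  then show ?thesis using assms r c by (auto simp: lollipop_def successively_append_iff hd_append)
qed

text \<open>Reroute: from \<open>e\<close> run backwards around the cycle to \<open>m\<close> and on
  to \<open>d\<close>. The chord from \<open>d\<close> to \<open>m\<close> closes the final stretch,
  and \<open>e\<close> and \<open>bs\<close> have moved to the path, so the new cycle is
  shorter.\<close>

lemma lollipop_shrink:
  assumes l: "lollipop U s ys (e # d # zs)" and m: "m \<in> set zs" "adj d m" "m \<noteq> hd zs"
  shows "\<exists>ys' ds'. lollipop U s ys' ds' \<and> length ds' < length (e # d # zs)"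
proof -
  obtain as bs where z: "zs = as @ m # bs" using m(1) by (meson split_list)
  have as: "as \<noteq> []" using m(3) z by auto
  have l': "distinct (ys @ e # d # zs)" "set (ys @ e # d # zs) = U" "successively adj (ys @ e # d # zs)"
    "hd (ys @ e # d # zs) = s" "adj (last zs) e"
    using l as z by (auto simp: lollipop_def cyc_def)
  have suc: "successively adj (ys @ [e])" "successively adj (d # as @ [m])" "successively adj (m # bs)"
    using l'(3) unfolding z by (auto simp: successively_append_iff successively_Cons hd_append split: if_splits)
  have srev: "successively adj (rev xs)" if "successively adj xs" for xs
    using that by (simp add: insert_commute)
  have "successively adj ((ys @ [e]) @ rev (m # bs))"
    using suc(1) srev[OF suc(3)] l'(5) z adj_sym[of "last zs" e]
    by (subst successively_append_iff) (auto simp: hd_rev hd_append split: if_splits)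
  moreover have "successively adj (m # rev as @ [d])" using srev[OF suc(2)] by simp
  ultimately have "successively adj (ys @ [e] @ rev bs @ m # rev as @ [d])"
    by (auto simp: successively_append_iff successively_Cons hd_append split: if_splits)
  moreover have "cyc adj (m # rev as @ [d])"
    using \<open>successively adj (m # rev as @ [d])\<close> as m(2) l'(1) z
    by (cases as) (auto simp: cyc_def)
  moreover have "hd (ys @ [e] @ rev bs @ m # rev as @ [d]) = s" using l'(4) by (cases ys) auto
  ultimately have "lollipop U s (ys @ [e] @ rev bs) (m # rev as @ [d])"
    using l'(1,2) z unfolding lollipop_def by auto
  moreover have "length (m # rev as @ [d]) < length (e # d # zs)" using z by simp
  ultimately show ?thesis by blast
qed

text \<open>The edge from \<open>d\<close> back to \<open>m\<close> closes the cycle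
  \<open>m # bs @ [e, d]\<close>. What it leaves consists of \<open>as\<close>, which contains
  \<open>s\<close>, and \<open>zs\<close>, which contains \<open>r\<close>; the edge from
  \<open>last zs\<close> to \<open>n\<close> joins the two.\<close>

lemma lollipop_cycle:
  assumes l: "lollipop U s ys (e # d # zs)" and ys: "ys = as @ m # bs" "n \<in> set as" "adj d m" "adj (last zs) n"
    and r: "r \<in> set zs" "r \<in> R"
  shows "\<exists>p. cyc adj p \<and> set p \<subseteq> U - {s} \<and> rest_reaches U R (set p)"
proof -
  have l': "distinct (ys @ e # d # zs)" "set (ys @ e # d # zs) = U" "successively adj (ys @ e # d # zs)"
    "hd (ys @ e # d # zs) = s"
    using l by (auto simp: lollipop_def)
  define p where "p = m # bs @ [e, d]"
  have suc: "successively adj (m # bs @ [e, d])" "successively adj as" "successively adj zs"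
    using l'(3) unfolding ys(1) by (auto simp: successively_append_iff successively_Cons hd_append split: if_splits)
  have "cyc adj p"
    using suc(1) l'(1) ys(1,3) by (auto simp: cyc_def p_def)
  moreover have sp: "set p \<subseteq> U - {s}"
  proof -
    have "s \<in> set as" using l'(4) ys(1,2) by (cases as) auto
    then show ?thesis using l'(1,2) ys(1) by (auto simp: p_def)
  qed
  moreover have "rest_reaches U R (set p)"
  proof -
    have co: "U - set p = set as \<union> set zs" using l'(1,2) ys(1) by (auto simp: p_def)
    have z: "reach adj (U - set p) w r" if "w \<in> set zs" for w
      using reach_path[OF suc(3) _ symp_adj that r(1)] co by auto
    have "reach adj (U - set p) w r" if w: "w \<in> set as" for w
    proof -
      have "zs \<noteq> []" using r by auto
      then have "reach adj (U - set p) n (last zs)" using ys(2,4) co adj_sym by (intro reach_step) auto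
      moreover have "reach adj (U - set p) w n" using reach_path[OF suc(2) _ symp_adj w ys(2)] co by auto
      ultimately show ?thesis using z[of "last zs"] \<open>zs \<noteq> []\<close>
          reach_trans[of adj "U - set p" w n "last zs"] reach_trans[of adj "U - set p" w "last zs" r] by simp
    qed
    then show ?thesis using z co r unfolding rest_reaches_def by auto
  qed
  ultimately show ?thesis by blast
qed

text \<open>If both alternatives fail, take a lollipop with the shortest cycle. Each neighbour of
  its entry point then has its third neighbour on the path before the cycle, and these two
  attachments give a cycle as in \<open>lollipop_cycle\<close>.\<close>

lemma path_or_cycle:
  assumes c: "cyc cadj c" "set c = U" and s: "s \<in> U" "exits U s"
    and R: "R = {r \<in> U. exits U r \<and> r \<noteq> s}" "R \<noteq> {}"
  shows "(\<exists>q. q \<noteq> [] \<and> distinct q \<and> successively adj q \<and> set q = U \<and> hd q = s \<and> last q \<in> R) \<or>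
    (\<exists>p. cyc adj p \<and> set p \<subseteq> U - {s} \<and> rest_reaches U R (set p))"
proof (rule ccontr)
  assume neg: "\<not> ?thesis"
  have UV: "U \<subseteq> V" using cyc_V c by blast
  obtain q where q: "cyc cadj (s # q)" "set (s # q) = U" using cyc_start c s by metis
  have "successively adj xs" if "successively cadj xs" for xs
    using that by (rule successively_mono) auto
  \<comment> \<open>The cycle itself, entered at \<open>s\<close> after an empty path, shows that
    lollipops exist.\<close>
  then have "lollipop U s [] (s # q)" using q by (auto simp: lollipop_def cyc_def)
  then obtain ys ds where l: "lollipop U s ys ds"
    and min: "\<And>ys' ds'. lollipop U s ys' ds' \<Longrightarrow> length ds \<le> length ds'"
    using ex_has_least_nat[of "\<lambda>(ys, ds). lollipop U s ys ds" "([], s # q)" "\<lambda>(ys, ds). length ds"]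
    by auto
  then have "length ds \<ge> 3" by (auto simp: lollipop_def cyc_def)
  then obtain e d zs where ds: "ds = e # d # zs" "zs \<noteq> []"
    by (cases ds; cases "tl ds"; cases "tl (tl ds)") auto
  define h where "h = last zs"
  define zs' where "zs' = tl (rev zs) @ [d]"
  have rz: "rev (d # zs) = h # zs'" using ds(2) by (simp add: zs'_def h_def rev_swap) (metis append_butlast_last_id butlast_rev hd_Cons_tl hd_rev last_rev rev_is_Nil_conv rev_rev_ident)
  have mir: "lollipop U s ys (e # h # zs')" using lollipop_mirror[of U s ys e "d # zs"] l ds rz by simp
  have lz': "last zs' = d" "zs' \<noteq> []" by (auto simp: zs'_def)
  have ham: "successively adj (ys @ [e] @ rev (d # zs))"
    using mir rz by (simp add: lollipop_def)
  have nb: "\<exists>m \<in> set ys. adj d m" if l: "lollipop U s ys (e # d # zs)" and len: "length (e # d # zs) = length ds" "zs \<noteq> []" for d zs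
  proof -
    have l': "distinct (ys @ e # d # zs)" "set (ys @ e # d # zs) = U" "hd (ys @ e # d # zs) = s"
      using l by (auto simp: lollipop_def)
    have dU: "d \<in> U" "d \<noteq> s" using l' by (auto simp: hd_append split: if_splits)
    \<comment> \<open>Going around the cycle in the direction that meets \<open>d\<close> last gives
      a Hamiltonian path ending at \<open>d\<close>.\<close>
    have "d \<notin> R"
    proof
      assume "d \<in> R"
      have "lollipop U s ys (e # rev (d # zs))" using lollipop_mirror[OF l] by simp
      then have "successively adj (ys @ e # rev (d # zs))" "distinct (ys @ e # rev (d # zs))"
        "set (ys @ e # rev (d # zs)) = U" "hd (ys @ e # rev (d # zs)) = s"
        by (simp_all add: lollipop_def)
      moreover have "last (ys @ e # rev (d # zs)) \<in> R" using \<open>d \<in> R\<close> by simp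
      ultimately show False using neg by blast
    qed
    then have "\<not> exits U d" using R(1) dU by simp
    then obtain m where m: "adj d m" "m \<in> U" "m \<noteq> e" "m \<noteq> hd zs" using third_nb dU(1) UV by blast
    have "m \<notin> set zs" using lollipop_shrink[OF l _ m(1,4)] min len(1) by fastforce
    then have "m \<in> set ys" using m l'(2) adj_neq[OF m(1)] by auto
    then show ?thesis using m(1) by blast
  qed
  have lds: "lollipop U s ys (e # d # zs)" using l ds by simp
  have "length (e # h # zs') = length ds" using ds by (simp add: zs'_def)
  then obtain m n where m: "m \<in> set ys" "adj d m" and n: "n \<in> set ys" "adj h n"
    using nb[OF lds] nb[OF mir _ lz'(2)] ds by auto
  have l': "distinct (ys @ e # d # zs)" "set (ys @ e # d # zs) = U" "successively adj (ys @ e # d # zs)"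
    "hd (ys @ e # d # zs) = s" "cyc adj (e # d # zs)"
    using lds by (auto simp: lollipop_def)
  have hz: "h \<in> set zs" "d \<noteq> h" "e \<noteq> h" "h \<notin> set ys" using ds(2) l'(1) by (auto simp: h_def)
  have eh: "adj h e" "adj e d" using l'(5) ds(2) by (auto simp: cyc_def h_def)
  have ysne: "ys \<noteq> []" using m by auto
  have sy: "s = hd ys" "s \<in> set ys" using l'(4) ysne by auto
  obtain r where r: "r \<in> R" using R(2) by blast
  \<comment> \<open>If \<open>r\<close> lay on the path, the cycle of the lollipop would do: its
    complement in \<open>U\<close> is that path.\<close>
  have "r \<notin> set ys"
  proof
    assume ry: "r \<in> set ys"
    have co: "U - set ds = set ys" using l'(1,2) ds by auto
    have sysuc: "successively adj ys" using l'(3) by (auto simp: successively_append_iff)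
    have "reach adj (U - set ds) w r" if "w \<in> set ys" for w
      using reach_path[OF sysuc _ symp_adj that ry] co by auto
    moreover have "r \<notin> set ds" using co ry by auto
    ultimately have "rest_reaches U R (set ds)" using co r unfolding rest_reaches_def by auto
    moreover have "cyc adj ds" "set ds \<subseteq> U - {s}" using l'(1,2,5) ds sy by auto
    ultimately show False using neg by blast
  qed
  moreover have "\<not> exits U e"
  proof
    assume "exits U e"
    moreover have "adj e (last ys)"
      using l'(3) ysne adj_sym[of "last ys" e] by (auto simp: successively_append_iff)
    moreover have "distinct [last ys, d, h]" using ysne hz l'(1) last_in_set[OF ysne] by auto
    moreover have "{last ys, d, h} \<subseteq> U" using hz ysne l'(2) by auto
    ultimately show False using exits_nbs[of U e "last ys" d h] eh adj_sym[OF eh(1)] by blast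
  qed
  ultimately have "r \<noteq> e" "r \<notin> set ys" using r R(1) by auto
  have notR: "x \<notin> R" if l: "lollipop U s ys (e # x # ws)" for x ws
  proof
    assume "x \<in> R"
    have "lollipop U s ys (e # rev (x # ws))" using lollipop_mirror[OF l] by simp
    then have "successively adj (ys @ e # rev (x # ws))" "distinct (ys @ e # rev (x # ws))"
      "set (ys @ e # rev (x # ws)) = U" "hd (ys @ e # rev (x # ws)) = s"
      by (simp_all add: lollipop_def)
    moreover have "last (ys @ e # rev (x # ws)) \<in> R" using \<open>x \<in> R\<close> by simp
    ultimately show False using neg by blast
  qed
  have "r \<in> U" using r R by simp
  then have rz: "r \<in> set zs" "r \<in> set zs'"
    using notR[OF lds] notR[OF mir] r \<open>r \<noteq> e\<close> \<open>r \<notin> set ys\<close> l'(2) mir unfolding lollipop_def by auto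
  \<comment> \<open>A common attachment is adjacent to \<open>d\<close>, \<open>h\<close> and its
    successor, so it cannot exit and is not \<open>s\<close>. It then also has a predecessor, a
    fourth neighbour.\<close>
  have "m \<noteq> n"
  proof
    assume mn: "m = n"
    obtain nx where nx: "consec (ys @ [e]) m nx"
      using ex_consec_next[of m "ys @ [e]"] m l'(1) by auto
    have "adj m nx"
      using consec_succ[OF _ nx] l'(3) by (auto simp: successively_append_iff)
    moreover have nxU: "nx \<in> set ys \<union> {e}" using consec_in[OF nx] by auto
    moreover have dis: "distinct [d, h, nx]" using nxU hz l'(1) by auto
    moreover have "{d, h, nx} \<subseteq> U" using nxU hz l'(2) by auto
    ultimately have "\<not> exits U m"
      using exits_nbs[of U m d h nx] adj_sym[OF m(2)] adj_sym[OF n(2)] mn by blast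
    then have "m \<noteq> hd ys" using s sy by auto
    then obtain pv where pv: "consec ys pv m" using ex_consec_prev m(1) by metis
    have "adj pv m" using consec_succ[OF _ pv] l'(3) by (auto simp: successively_append_iff)
    moreover have "pv \<in> set ys" using consec_in[OF pv] by simp
    moreover have "pv \<noteq> nx"
    proof
      assume "pv = nx"
      then have "nx \<noteq> e" using \<open>pv \<in> set ys\<close> l'(1) by auto
      have d: "distinct (ys @ [e])" using l'(1) by auto
      have "consec (ys @ [e]) pv m" using pv by (rule consec_append)
      then have "pos (ys @ [e]) m = Suc (pos (ys @ [e]) pv)" "pos (ys @ [e]) nx = Suc (pos (ys @ [e]) m)"
        using consec_pos[OF d] nx by blast+
      then show False using \<open>pv = nx\<close> by simp
    qed
    ultimately show False
      using four_nbs[of m d h nx pv] \<open>adj m nx\<close> adj_sym[OF m(2)] adj_sym[OF n(2)] mn dis hz l'(1) adj_sym[of pv m] by auto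
  qed
  obtain as bs where ab: "ys = as @ m # bs" using m(1) by (meson split_list)
  \<comment> \<open>Whichever of \<open>m\<close> and \<open>n\<close> comes first on the path, the
    mirrored lollipop covers the other order.\<close>
  have "\<exists>p. cyc adj p \<and> set p \<subseteq> U - {s} \<and> rest_reaches U R (set p)"
  proof (cases "n \<in> set as")
    case True
    then show ?thesis using lollipop_cycle[OF lds ab True m(2) _ rz(1) r] n(2) by (simp add: h_def)
  next
    case False
    then have "n \<in> set bs" using n(1) ab \<open>m \<noteq> n\<close> by auto
    then obtain b1 b2 where "bs = b1 @ n # b2" by (meson split_list)
    then have "ys = (as @ m # b1) @ n # b2" using ab by simp
    from lollipop_cycle[OF mir this _ n(2) _ rz(2) r, of m] show ?thesis using lz'(1) m(2) by simp
  qed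
  then show False using neg by blast
qed

section \<open>Decompositions from partial data\<close>

text \<open>The tree is a smallest connected edge set between the edges forced into the tree, those outside
  \<open>M\<close> or meeting \<open>VH\<close> or an edge of \<open>N0\<close>, and all edges outside the 2-regular graph and \<open>N0\<close>. The
  ranking certifies that the forced edges form a forest.\<close>

lemma decomposition:
  assumes G: "vertices G = V" "edges G = E"
    and VH: "VH \<subseteq> V" "\<And>v. v \<in> VH \<Longrightarrow> card {w \<in> VH. adj v w} = 2"
    and N0: "N0 \<subseteq> E" "\<And>e f. e \<in> N0 \<Longrightarrow> f \<in> N0 \<Longrightarrow> e \<noteq> f \<Longrightarrow> e \<inter> f = {}" "\<And>e. e \<in> N0 \<Longrightarrow> e \<inter> VH = {}"
    and conn: "V - VH \<noteq> {}"
      "\<And>v w. v \<in> V - VH \<Longrightarrow> w \<in> V - VH \<Longrightarrow> reach (\<lambda>a b. {a, b} \<in> E - N0) (V - VH) v w"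
    and rank: "\<And>v w w'. {v, w} \<in> E - N0 \<Longrightarrow> {v, w} \<notin> M \<or> v \<in> \<Union> N0 \<or> w \<in> \<Union> N0 \<Longrightarrow>
      {v, w'} \<in> E - N0 \<Longrightarrow> {v, w'} \<notin> M \<or> v \<in> \<Union> N0 \<or> w' \<in> \<Union> N0 \<Longrightarrow>
      v \<in> V - VH \<Longrightarrow> w \<in> V - VH \<Longrightarrow> w' \<in> V - VH \<Longrightarrow>
      rk w \<le> rk v \<Longrightarrow> rk w' \<le> (rk v :: nat) \<Longrightarrow> w = w'"
  shows "\<exists>T H N. three_decomposition G T H N"
proof -
  \<comment> \<open>All edges induced by \<open>VH\<close>; the degree hypothesis on
    \<open>VH\<close> is about induced degrees, so this graph is 2-regular.\<close>
  define H where "H = {e \<in> E. e \<subseteq> VH}"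
  define A where "A = E - H - N0"
  define F where "F = {e \<in> A. e \<notin> M \<or> e \<inter> (VH \<union> \<Union> N0) \<noteq> {}}"
  define spans where "spans X \<longleftrightarrow> (\<forall>u\<in>V. \<forall>v\<in>V. reach (\<lambda>a b. {a, b} \<in> X) V u v)" for X
  have sym: "symp (\<lambda>a b. {a, b} \<in> X)" for X :: "'a set set" by (auto simp: symp_def insert_commute)
  have finE: "finite E" by (rule finite_subset[of _ "Pow V"]) (use edge fin in auto)
  have deg2: "\<exists>x. adj v x \<and> x \<notin> VH" if v: "v \<in> VH" for v
  proof (rule ccontr)
    assume "\<not> ?thesis"
    then have "{w \<in> VH. adj v w} = {w. adj v w}" by auto
    then show False using VH(2)[OF v] card_nbs[of v] v VH(1) by auto
  qed
  have toA: "reach (\<lambda>a b. {a, b} \<in> A) V v w" if vw: "v \<in> V - VH" "w \<in> V - VH" for v w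
    by (rule reach_mono[OF conn(2)[OF vw]]) (auto simp: A_def H_def)
  have out: "\<exists>x \<in> V - VH. reach (\<lambda>a b. {a, b} \<in> A) V v x" if v: "v \<in> V" for v
  proof (cases "v \<in> VH")
    case True
    then obtain x where x: "adj v x" "x \<notin> VH" using deg2 by blast
    then have "{v, x} \<in> A" using N0(3)[of "{v, x}"] True by (auto simp: A_def H_def)
    then have "reach (\<lambda>a b. {a, b} \<in> A) V v x" using adj_V[OF x(1)] by (intro reach_step) auto
    then show ?thesis using x adj_V[OF x(1)] by blast
  next
    case False
    then show ?thesis using v by (intro bexI[of _ v]) auto
  qed
  have spansA: "spans A"
    unfolding spans_def
  proof (intro ballI)
    fix u v assume uv: "u \<in> V" "v \<in> V"
    obtain x where x: "x \<in> V - VH" "reach (\<lambda>a b. {a, b} \<in> A) V u x" using out[OF uv(1)] by blast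
    obtain y where y: "y \<in> V - VH" "reach (\<lambda>a b. {a, b} \<in> A) V v y" using out[OF uv(2)] by blast
    show "reach (\<lambda>a b. {a, b} \<in> A) V u v"
      using reach_trans[OF x(2) reach_trans[OF toA[OF x(1) y(1)] reach_sym[OF sym y(2)]]] .
  qed
  have "F \<subseteq> A" by (auto simp: F_def)
  \<comment> \<open>Minimality is required only among sets containing \<open>F\<close>: a cycle in
    \<open>X\<close> then has an edge outside \<open>F\<close> to spare, provided that
    \<open>F\<close> itself is acyclic.\<close>
  then obtain X where X: "F \<subseteq> X" "X \<subseteq> A" "spans X"
    and min: "\<And>Y. F \<subseteq> Y \<Longrightarrow> Y \<subseteq> A \<Longrightarrow> spans Y \<Longrightarrow> card X \<le> card Y"
    using ex_has_least_nat[of "\<lambda>Y. F \<subseteq> Y \<and> Y \<subseteq> A \<and> spans Y" A card] spansA by auto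
  have finX: "finite X" using X(2) finE by (auto simp: A_def intro: finite_subset)
  have noF: "\<not> cyc (\<lambda>a b. {a, b} \<in> F) p" for p
  proof
    assume p: "cyc (\<lambda>a b. {a, b} \<in> F) p"
    have two: "\<exists>a b. a \<noteq> b \<and> {v, a} \<in> F \<and> {v, b} \<in> F \<and> a \<in> set p \<and> b \<in> set p" if v: "v \<in> set p" for v
    proof -
      obtain q where q: "cyc (\<lambda>a b. {a, b} \<in> F) (v # q)" "set (v # q) = set p" using cyc_start[OF p v] by metis
      have q': "length q \<ge> 2" "distinct q" "{v, hd q} \<in> F" "{last q, v} \<in> F"
        using q(1) by (simp_all add: cyc_Cons_iff)
      then have "q \<noteq> []" by auto
      then have "hd q \<in> set q" "last q \<in> set q" by simp_all
      then have "hd q \<in> set p" "last q \<in> set p" unfolding q(2)[symmetric] by simp_all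
      then show ?thesis using q' hd_neq_last[OF q'(2,1)] insert_commute[of v "last q" "{}"]
        by (intro exI[of _ "hd q"] exI[of _ "last q"]) simp
    qed
    \<comment> \<open>Two of the three edges at a vertex of \<open>VH\<close> belong to
      \<open>H\<close>, so at most one is in \<open>F\<close> and no cycle of \<open>F\<close>
      passes through it.\<close>
    have pV: "v \<in> V - VH" if v: "v \<in> set p" for v
    proof -
      obtain a b where ab: "a \<noteq> b" "{v, a} \<in> F" "{v, b} \<in> F" using two v by blast
      then have adj: "adj v a" "adj v b" by (auto simp: F_def A_def)
      have "v \<notin> VH"
      proof
        assume vH: "v \<in> VH"
        then have "a \<notin> VH" "b \<notin> VH" using ab(2,3) by (auto simp: F_def A_def H_def)
        then have "card ({w \<in> VH. adj v w} \<union> {a, b}) = 4"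
          using VH(2)[OF vH] ab(1) by (subst card_Un_disjoint) (auto intro: card_ge_0_finite)
        moreover have "card ({w \<in> VH. adj v w} \<union> {a, b}) \<le> card {w. adj v w}"
          using adj by (intro card_mono finite_nbs) auto
        ultimately show False using card_nbs[of v] vH VH(1) by auto
      qed
      then show ?thesis using adj_V[OF adj(1)] by simp
    qed
    have "set p \<noteq> {}" using p by (auto simp: cyc_def)
    \<comment> \<open>At a vertex of maximal rank on the cycle both cycle neighbours have no larger
      rank, which the rank hypothesis forbids.\<close>
    then obtain v where v: "v \<in> set p" "\<And>w. w \<in> set p \<Longrightarrow> rk w \<le> rk v"
      using obtains_MAX[of "set p" rk] by (metis List.finite_set Max_ge finite_imageI image_eqI)
    obtain a b where ab: "a \<noteq> b" "{v, a} \<in> F" "{v, b} \<in> F" "a \<in> set p" "b \<in> set p" using two v by blast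
    have *: "{v, x} \<in> E - N0 \<and> ({v, x} \<notin> M \<or> v \<in> \<Union> N0 \<or> x \<in> \<Union> N0)" if "{v, x} \<in> F" "x \<in> set p" for x
      using that pV[OF v(1)] pV[of x] by (auto simp: F_def A_def)
    show False
      using rank[of v a b] *[OF ab(2,4)] *[OF ab(3,5)] pV[OF v(1)] pV[OF ab(4)] pV[OF ab(5)] v(2)[OF ab(4)] v(2)[OF ab(5)] ab(1)
      by blast
  qed
  have acyclic: "\<not> cyc (\<lambda>a b. {a, b} \<in> X) p0" for p0
  proof
    assume "cyc (\<lambda>a b. {a, b} \<in> X) p0"
    \<comment> \<open>Some edge of the cycle is not forced. Closing position lets the rest of the
      list replace it, so deleting it keeps \<open>X\<close> spanning and contradicts
      minimality.\<close>
    then obtain p where p: "cyc (\<lambda>a b. {a, b} \<in> X) p" "{last p, hd p} \<notin> F"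
      using cyc_bad_edge[of _ p0 "\<lambda>a b. {a, b} \<in> F"] noF by metis
    define e where "e = {last p, hd p}"
    have eX: "e \<in> X" using p(1) by (simp add: cyc_def e_def)
    have ne: "p \<noteq> []" using p(1) by (auto simp: cyc_def)
    have "successively (\<lambda>a b. {a, b} \<in> X - {e}) p"
    proof (rule ccontr)
      assume "\<not> ?thesis"
      then obtain a b where ab: "consec p a b" "{a, b} \<notin> X - {e}" using not_successively_consec by fastforce
      moreover have "{a, b} \<in> X" using consec_succ[OF _ ab(1), of "\<lambda>a b. {a, b} \<in> X"] p(1) by (simp add: cyc_def)
      ultimately show False using cyc_no_short_edge[OF p(1) ab(1)] by (simp add: e_def)
    qed
    moreover have pV: "set p \<subseteq> V"
    proof
      fix v assume "v \<in> set p"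
      then obtain q where "cyc (\<lambda>a b. {a, b} \<in> X) (v # q)" using cyc_start[OF p(1)] by metis
      then have "adj v (hd q)" using X(2) by (auto simp: cyc_Cons_iff A_def)
      then show "v \<in> V" using adj_V by blast
    qed
    ultimately have lh: "reach (\<lambda>a b. {a, b} \<in> X - {e}) V (last p) (hd p)"
      using ne by (intro reach_path[of _ p] sym) auto
    have "spans (X - {e})" unfolding spans_def
    proof (intro ballI)
      fix u v assume "u \<in> V" "v \<in> V"
      then have "reach (\<lambda>a b. {a, b} \<in> X) V u v" using X(3) by (simp add: spans_def)
      then show "reach (\<lambda>a b. {a, b} \<in> X - {e}) V u v"
        unfolding reach_def[of "\<lambda>a b. {a, b} \<in> X"]
      proof (induction rule: rtranclp_induct)
        case (step y z)
        have "reach (\<lambda>a b. {a, b} \<in> X - {e}) V y z"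
        proof (cases "{y, z} = e")
          case True
          then have "y = last p \<and> z = hd p \<or> z = last p \<and> y = hd p" by (auto simp: e_def doubleton_eq_iff)
          then show ?thesis using lh reach_sym[OF sym lh] by auto
        next
          case False
          then show ?thesis using step(2) by (intro reach_step) auto
        qed
        then show ?case using reach_trans[OF step.IH] by blast
      qed simp
    qed
    moreover have "F \<subseteq> X - {e}" "X - {e} \<subseteq> A" using X p(2) by (auto simp: e_def)
    ultimately have "card X \<le> card (X - {e})" using min by blast
    then show False using card_Diff1_less[OF finX eX] by simp
  qed
  define N where "N = N0 \<union> (A - X)"
  define T where "T = \<lparr>vertices = V, edges = X\<rparr>"
  define HG where "HG = \<lparr>vertices = VH, edges = H\<rparr>"
  have XE: "X \<subseteq> E" using X(2) by (auto simp: A_def)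
  have "V \<noteq> {}" using conn(1) by auto
  have walk: "\<exists>p. graph_walk T u p v" if uv: "u \<in> V" "v \<in> V" for u v
  proof -
    have "reach (\<lambda>a b. {a, b} \<in> X) V u v" using X(3) uv by (simp add: spans_def)
    then obtain p where "p \<noteq> []" "hd p = u" "last p = v" "successively (\<lambda>a b. {a, b} \<in> X) p" "set p \<subseteq> V"
      using reach_simple_path uv(1) by metis
    then show ?thesis by (auto simp: graph_walk_def T_def)
  qed
  have "tree_graph T"
    unfolding tree_graph_def connected_graph_def
  proof (intro conjI)
    show "\<nexists>p. graph_cycle T p"
      using acyclic by (auto simp: graph_cycle_def graph_walk_def cyc_def T_def)
  qed (use walk \<open>V \<noteq> {}\<close> in \<open>auto simp: T_def\<close>)
  moreover have "subgraph_of T G"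
    using XE edge fin G by (auto simp: subgraph_of_def finite_simple_graph_def T_def)
  ultimately have "spanning_tree_of T G" using G by (simp add: spanning_tree_of_def T_def)
  moreover have "subgraph_of HG G"
    using VH(1) edge fin G by (auto simp: subgraph_of_def finite_simple_graph_def HG_def H_def intro: finite_subset)
  moreover have "regular_graph 2 HG"
    unfolding regular_graph_def
  proof
    fix v assume "v \<in> vertices HG"
    then have v: "v \<in> VH" by (simp add: HG_def)
    have "{e \<in> H. v \<in> e} = (\<lambda>w. {v, w}) ` {w \<in> VH. adj v w}" (is "?L = ?R")
    proof
      show "?L \<subseteq> ?R"
      proof
        fix e assume e: "e \<in> ?L"
        then have "e \<in> (\<lambda>w. {v, w}) ` {w. adj v w}" using edges_at[of v] by (auto simp: H_def)
        then show "e \<in> ?R" using e by (auto simp: H_def)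
      qed
    qed (use v in \<open>auto simp: H_def\<close>)
    then show "degree_of HG v = 2"
      using VH(2)[OF v] card_image[OF inj_on_subset[OF inj_edge[of v]], of "{w \<in> VH. adj v w}"]
      by (simp add: degree_of_def HG_def)
  qed
  moreover have "matching_of N G"
    unfolding matching_of_def
  proof (intro conjI ballI impI)
    show "N \<subseteq> edges G" using N0(1) G by (auto simp: N_def A_def)
  next
    fix e f assume ef: "e \<in> N" "f \<in> N" "e \<noteq> f"
    \<comment> \<open>Everything forced is in \<open>X\<close>, so the edges dropped from
      \<open>A\<close> belong to \<open>M\<close> and avoid \<open>N0\<close>; together with
      \<open>N0\<close> they remain a matching.\<close>
    have late: "g \<in> M \<and> g \<inter> \<Union> N0 = {}" if "g \<in> A - X" for g
      using that X(1) by (auto simp: F_def)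
    show "e \<inter> f = {}"
    proof (cases "e \<in> N0"; cases "f \<in> N0")
      assume "e \<in> N0" "f \<notin> N0"
      then show ?thesis using late[of f] ef by (auto simp: N_def)
    next
      assume "e \<notin> N0" "f \<in> N0"
      then show ?thesis using late[of e] ef by (auto simp: N_def)
    next
      assume "e \<notin> N0" "f \<notin> N0"
      then show ?thesis using late[of e] late[of f] ef M_disj[of e f] by (simp add: N_def)
    qed (use N0(2) ef in blast)
  qed
  moreover have "edges G = edges T \<union> edges HG \<union> N"
    using XE N0(1) G by (auto simp: T_def HG_def N_def A_def H_def)
  moreover have "edges T \<inter> edges HG = {}" "edges T \<inter> N = {}"
    using X(2) by (auto simp: T_def HG_def N_def A_def)
  moreover have "edges HG \<inter> N = {}"
  proof -
    have "e \<notin> N0" if "e \<in> H" for e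
    proof
      assume "e \<in> N0"
      then have "e = {}" using N0(3)[of e] that by (auto simp: H_def)
      then show False using that edge[of e] by (simp add: H_def)
    qed
    then show ?thesis by (auto simp: HG_def N_def A_def)
  qed
  ultimately have "three_decomposition G T HG N" by (simp add: three_decomposition_def)
  then show ?thesis by blast
qed

section \<open>The cycles of \<open>G - M\<close> partition the vertices\<close>

lemma two_cadj:
  assumes "v \<in> V" obtains a b where "a \<noteq> b" "\<And>w. cadj v w \<longleftrightarrow> w = a \<or> w = b"
proof -
  have "card ({w. adj v w} - {mate v}) = 2"
    using card_nbs[OF assms] adj_mate[OF assms] finite_nbs by (simp add: card_Diff_singleton)
  then obtain a b where ab: "{w. adj v w} - {mate v} = {a, b}" "a \<noteq> b" by (meson card_2_iff)
  have "cadj v w \<longleftrightarrow> w \<in> {w. adj v w} - {mate v}" for w using M_iff[OF assms] by auto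
  then show thesis using that[of a b] ab by simp
qed

text \<open>A longest path of \<open>G - M\<close> from \<open>v\<close> has all neighbours of its
  last vertex on it. The neighbour that does not precede the last vertex must be \<open>v\<close>,
  since an inner vertex would get a third edge of \<open>G - M\<close>; hence the cycle passes
  through \<open>v\<close> itself.\<close>

lemma ex_cyc:
  assumes v: "v \<in> V" shows "\<exists>p. cyc cadj p \<and> v \<in> set p"
proof -
  define path where "path p \<longleftrightarrow> p \<noteq> [] \<and> hd p = v \<and> distinct p \<and> successively cadj p \<and> set p \<subseteq> V" for p
  have "path [v]" using v by (simp add: path_def)
  moreover have "length p < Suc (card V)" if "path p" for p
    using that card_mono[OF fin, of "set p"] distinct_card[of p] by (simp add: path_def)
  ultimately obtain p where p: "path p" "\<And>p'. path p' \<Longrightarrow> length p' \<le> length p"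
    using ex_has_greatest_nat[of path "[v]" length] by blast
  have p': "p \<noteq> []" "hd p = v" "distinct p" "successively cadj p" "set p \<subseteq> V" using p(1) by (auto simp: path_def)
  have lV: "last p \<in> V" using p' by auto
  have inp: "w \<in> set p" if w: "cadj (last p) w" for w
  proof (rule ccontr)
    assume n: "w \<notin> set p"
    have "w \<in> V" using w adj_V by blast
    then have "path (p @ [w])" using p' n w by (auto simp: path_def successively_append_iff)
    then show False using p(2) by fastforce
  qed
  obtain a b where ab: "a \<noteq> b" "\<And>w. cadj (last p) w \<longleftrightarrow> w = a \<or> w = b" using two_cadj[OF lV] by metis
  have "\<exists>y. cadj (last p) y \<and> \<not> consec p y (last p)"
    using ab consec_pred_unique[OF p'(3)] by metis
  then obtain y where y: "cadj (last p) y" "\<not> consec p y (last p)" by blast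
  have yl: "y \<noteq> last p" using y(1) adj_neq by blast
  have sym: "cadj b a" if "cadj a b" for a b using that by (simp add: insert_commute)
  have "y = hd p"
  proof (rule ccontr)
    assume "y \<noteq> hd p"
    then obtain z where z: "consec p z y" using ex_consec_prev inp[OF y(1)] by metis
    obtain x where x: "consec p y x" using ex_consec_next[OF inp[OF y(1)] yl] by blast
    have "y \<in> V" using y(1) adj_V by blast
    then obtain c d where cd: "\<And>w. cadj y w \<longleftrightarrow> w = c \<or> w = d" using two_cadj by metis
    have "z \<noteq> x" using consec_pos[OF p'(3) z] consec_pos[OF p'(3) x] by auto
    moreover have "x \<noteq> last p" using x y(2) by blast
    moreover have "z \<noteq> last p" using consec_last[OF p'(3) z] .
    moreover have "cadj y z" "cadj y x" "cadj y (last p)"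
      using sym[OF consec_succ[OF p'(4) z]] consec_succ[OF p'(4) x] sym[OF y(1)] by simp_all
    ultimately show False using cd by metis
  qed
  have "length p \<ge> 3"
  proof (rule ccontr)
    assume "\<not> ?thesis"
    then consider s where "p = [s]" | s t where "p = [s, t]" using p'(1)
      by (cases p; cases "tl p") (auto simp: Suc_le_eq numeral_3_eq_3 not_less_eq)
    then show False
    proof cases
      case 1
      then show False using \<open>y = hd p\<close> yl by simp
    next
      case (2 s t)
      then have "consec p y (last p)" using \<open>y = hd p\<close> by (auto simp: consec_def)
      then show False using y(2) by simp
    qed
  qed
  then have "cyc cadj p" using p' y(1) \<open>y = hd p\<close> by (simp add: cyc_def)
  then show ?thesis using p'(1,2) by (metis hd_in_set)
qed

text \<open>Only edges of \<open>M\<close> leave a cycle of \<open>G - M\<close>, so its vertex set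
  is closed under \<open>cadj\<close>, and the second cycle cannot leave it after the common
  vertex.\<close>

lemma cyc_overlap:
  assumes p: "cyc cadj p" "cyc cadj p'" "v \<in> set p" "v \<in> set p'"
  shows "set p' \<subseteq> set p"
proof
  fix w assume w: "w \<in> set p'"
  have "reach cadj (set p') v w"
    using p(2) by (intro reach_path[OF _ subset_refl symp_cadj p(4) w]) (simp add: cyc_def)
  then show "w \<in> set p"
  proof (rule reach_closed[OF _ p(3)])
    fix x y assume x: "x \<in> set p" and xy: "cadj x y"
    show "y \<in> set p"
    proof (rule ccontr)
      assume "y \<notin> set p"
      then have "y = mate x" using outside_nb[OF p(1) x] xy by blast
      then show False using xy mate_M[of x] adj_V by blast
    qed
  qed
qed

end

section \<open>Star-like graphs\<close>

text \<open>The star appears only as the statement that an edge of \<open>M\<close> leaving an outer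
  cycle ends in the centre. \<open>Os\<close> may be empty; the centre is then a Hamiltonian
  cycle.\<close>

locale star_matched = cubic_matched +
  fixes C :: "'a set" and Os :: "'a set set"
  assumes center: "\<exists>c. cyc cadj c \<and> set c = C"
    and outer: "U \<in> Os \<Longrightarrow> \<exists>c. cyc cadj c \<and> set c = U"
    and outer_center: "U \<in> Os \<Longrightarrow> U \<inter> C = {}"
    and outer_disj: "U \<in> Os \<Longrightarrow> U' \<in> Os \<Longrightarrow> U \<noteq> U' \<Longrightarrow> U \<inter> U' = {}"
    and cover: "V = C \<union> \<Union> Os"
    and star: "U \<in> Os \<Longrightarrow> v \<in> U \<Longrightarrow> mate v \<notin> U \<Longrightarrow> mate v \<in> C"
begin

lemma outer_V: "U \<in> Os \<Longrightarrow> U \<subseteq> V"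
  using cover by blast

lemma outer_nb:
  assumes "U \<in> Os" "a \<in> U" "adj a b" "b \<notin> U" shows "b = mate a" "b \<in> C"
proof -
  obtain c where c: "cyc cadj c" "set c = U" using outer assms(1) by blast
  show "b = mate a" using outside_nb[OF c(1) _ assms(3)] assms c(2) by simp
  then show "b \<in> C" using star assms by blast
qed

lemma exits_outer: "U \<in> Os \<Longrightarrow> a \<in> U \<Longrightarrow> exits U a \<longleftrightarrow> mate a \<in> C"
  using outer_nb[of U a] adj_mate[of a] outer_V outer_center unfolding exits_def by blast

text \<open>The ends in \<open>C\<close> of the edges between \<open>U\<close> and \<open>C\<close>
  separate \<open>U\<close> from the rest. If there were fewer than three, the centre would consist
  of them alone, but a cycle has at least three vertices.\<close>

lemma card_feet:
  assumes "U \<in> Os" shows "card {x \<in> C. mate x \<in> U} \<ge> 3"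
proof (rule ccontr)
  assume "\<not> ?thesis"
  moreover define X where "X = {x \<in> C. mate x \<in> U}"
  ultimately have X: "card X < 3" by simp
  obtain c where c: "cyc cadj c" "set c = U" using outer assms by blast
  obtain d where d: "cyc cadj d" "set d = C" using center by blast
  have "V \<subseteq> U \<union> X"
  proof (rule sep)
    show "X \<subseteq> V" "U \<subseteq> V" using cover assms by (auto simp: X_def)
    show "U \<noteq> {}" using c by (auto simp: cyc_def)
    show "U \<inter> X = {}" using outer_center assms by (auto simp: X_def)
    show "b \<in> U \<union> X" if ab: "a \<in> U" "adj a b" for a b
    proof (cases "b \<in> U")
      case False
      then have "b = mate a" "b \<in> C" using outer_nb[OF assms ab] by auto
      moreover have "mate (mate a) = a" using ab(1) outer_V[OF assms] by (intro mate_mate) blast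
      ultimately show ?thesis using ab by (simp add: X_def)
    qed simp
  qed (rule X)
  then have "C \<subseteq> X" using cover outer_center[OF assms] by blast
  moreover have "finite X" using fin cover by (auto simp: X_def intro: finite_subset)
  ultimately have "card C \<le> card X" by (rule card_mono[rotated])
  then show False using X d distinct_card[of d] by (auto simp: cyc_def)
qed

text \<open>Edges of \<open>G - M\<close> within the cycle are consecutive in its list except for
  the closing one. Excluding the head of the list disposes of that edge; in the applications the
  head lies on the 2-regular graph.\<close>

lemma cadj_consec:
  assumes c: "cyc cadj q" and a: "a \<in> set q" "a \<noteq> hd q" and b: "cadj a b" "b \<noteq> hd q"
  shows "consec q a b \<or> consec q b a"
proof -
  obtain xs ys where q: "q = xs @ a # ys" using a by (meson split_list)
  have xs: "xs \<noteq> []" using a(2) q by auto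
  have "cyc cadj ((a # ys) @ xs)" using cyc_rotate c q by metis
  then have "{w. adj a w} = {hd (ys @ xs), last (ys @ xs), mate a}"
    using cyc_nbs(1)[of a "ys @ xs"] by simp
  moreover have "b \<in> {w. adj a w}" using b(1) by simp
  moreover have "b \<noteq> mate a" using b(1) adj_V mate_M by blast
  ultimately have "b = hd (ys @ xs) \<or> b = last xs" using xs by simp
  then show ?thesis
  proof
    assume b1: "b = hd (ys @ xs)"
    then have "ys \<noteq> []" using b(2) q xs by auto
    then have "q = xs @ a # b # tl ys" using q b1 by simp
    then show ?thesis unfolding consec_def by blast
  next
    assume "b = last xs"
    then have "q = butlast xs @ b # a # ys" using q xs by simp
    then show ?thesis unfolding consec_def by blast
  qed
qed

text \<open>How an outer cycle \<open>U\<close> takes part in the decomposition when the arc \<open>P\<close> of the centre is used by the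
  2-regular graph: \<open>D\<close> are the vertices of \<open>U\<close> on the 2-regular graph, \<open>N\<close> the edges inside \<open>U\<close> put into
  the matching beforehand, and the tree edges that are forced inside \<open>U\<close> join neighbours in the
  list \<open>q\<close>. Only the head of \<open>q\<close> may have a forced edge to the rest of the centre, so these
  edges close no cycle.\<close>

definition piece :: "'a set \<Rightarrow> 'a set \<Rightarrow> 'a set \<Rightarrow> 'a set set \<Rightarrow> 'a list \<Rightarrow> bool" where
  "piece P U D N q \<longleftrightarrow> D \<subseteq> U \<and> distinct q \<and> set q = U \<and> N \<subseteq> E \<and> (\<forall>e\<in>N. e \<subseteq> U - D) \<and>
     (\<forall>e\<in>N. \<forall>f\<in>N. e \<noteq> f \<longrightarrow> e \<inter> f = {}) \<and>
     (\<forall>a\<in>U - D. \<forall>b\<in>U - D. {a, b} \<in> E - N \<and> ({a, b} \<notin> M \<or> a \<in> \<Union> N \<or> b \<in> \<Union> N) \<longrightarrow>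
        consec q a b \<or> consec q b a) \<and>
     (\<forall>a\<in>U \<inter> \<Union> N. mate a \<notin> U \<union> P \<longrightarrow> a = hd q) \<and>
     (\<forall>w\<in>U - D. \<exists>r\<in>U - D. mate r \<in> C - P \<and> reach (\<lambda>a b. {a, b} \<in> E - N) (U - D) w r)"

text \<open>A vertex of \<open>D\<close> at the head of the list breaks the cycle open. Nothing
  needs to enter the matching early, so \<open>N\<close> is empty and no edge of \<open>M\<close> is
  forced.\<close>

lemma broken_piece:
  assumes U: "U \<in> Os" and D: "D \<subseteq> U" "D \<noteq> {}"
    and R: "\<And>r. r \<in> R - D \<Longrightarrow> r \<in> U \<and> mate r \<in> C - P" and ok: "rest_reaches U R D"
  shows "\<exists>N q. piece P U D N q"
proof -
  obtain c where c: "cyc cadj c" "set c = U" using outer U by blast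
  obtain d where d: "d \<in> D" using D by blast
  obtain q where q: "cyc cadj (d # q)" "set (d # q) = U" using cyc_start[OF c(1), of d] c(2) D d by blast
  have "consec (d # q) a b \<or> consec (d # q) b a" if "a \<in> U - D" "b \<in> U - D" "{a, b} \<in> E - M" for a b
    using cadj_consec[OF q(1), of a b] that d q(2) by auto
  moreover have "\<exists>r\<in>U - D. mate r \<in> C - P \<and> reach (\<lambda>a b. {a, b} \<in> E - {}) (U - D) w r" if w: "w \<in> U - D" for w
  proof -
    obtain r where r: "r \<in> R - D" "reach adj (U - D) w r" using ok w unfolding rest_reaches_def by auto
    then show ?thesis using R[OF r(1)] by (intro bexI[of _ r]) auto
  qed
  ultimately have "piece P U D {} (d # q)"
    unfolding piece_def using D(1) q by (simp add: cyc_def)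
  then show ?thesis by blast
qed

text \<open>All edges inside \<open>U\<close> off the path form \<open>N\<close>. They are a
  matching because each vertex has at most one of them: an inner vertex has two path edges, and an
  end has one path edge and a mate outside \<open>U\<close>. An inner vertex on \<open>N\<close> has
  no edge to the centre, and the mate of \<open>last q\<close> lies in \<open>P\<close>, so only
  \<open>hd q\<close> can be linked to the rest of the centre.\<close>

lemma path_piece:
  assumes U: "U \<in> Os" and P: "P \<subseteq> C"
    and q: "q \<noteq> []" "distinct q" "successively adj q" "set q = U" "hd q \<noteq> last q"
    and ends: "mate (hd q) \<in> C - P" "mate (last q) \<in> P"
  shows "\<exists>N. piece P U {} N q"
proof -
  define N where "N = {{a, b} | a b. adj a b \<and> a \<in> U \<and> b \<in> U \<and> \<not> consec q a b \<and> \<not> consec q b a}"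
  have N_iff: "{a, b} \<in> N \<longleftrightarrow> adj a b \<and> a \<in> U \<and> b \<in> U \<and> \<not> consec q a b \<and> \<not> consec q b a" for a b
    unfolding N_def by (auto simp: doubleton_eq_iff insert_commute)
  have N_ex: "\<exists>w. e = {v, w} \<and> {v, w} \<in> N" if e: "e \<in> N" "v \<in> e" for e v
  proof -
    obtain a b where ab: "e = {a, b}" using e(1) unfolding N_def by blast
    then have "e = {v, a} \<or> e = {v, b}" using e(2) by auto
    then show ?thesis using e(1) by auto
  qed
  have out: "mate v \<notin> U" if "v = hd q \<or> v = last q" for v
    using that ends P outer_center[OF U] by blast
  have UV: "U \<subseteq> V" using outer_V U .
  have nexts: "\<exists>x. consec q v x \<and> adj v x \<and> x \<in> U" if v: "v \<in> U" "v \<noteq> last q" for v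
  proof -
    obtain x where "consec q v x" using ex_consec_next[of v q] v q(4) by auto
    then show ?thesis using consec_succ[OF q(3)] consec_in[of q v x] q(4) by auto
  qed
  have prevs: "\<exists>x. consec q x v \<and> adj v x \<and> x \<in> U" if v: "v \<in> U" "v \<noteq> hd q" for v
  proof -
    obtain x where x: "consec q x v" using ex_consec_prev[of v q] v q(4) by auto
    then show ?thesis using adj_sym[OF consec_succ[OF q(3) x]] consec_in[OF x] q(4) by auto
  qed
  have inner: "w1 = w2"
    if v: "v \<in> U" "v \<noteq> hd q" "v \<noteq> last q" and w: "adj v w1" "adj v w2"
      "\<not> consec q v w1" "\<not> consec q w1 v" "\<not> consec q v w2" "\<not> consec q w2 v" for v w1 w2
  proof (rule ccontr)
    assume ne: "w1 \<noteq> w2"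
    obtain x where x: "consec q v x" "adj v x" using nexts v by blast
    obtain y where y: "consec q y v" "adj v y" using prevs v by blast
    have "x \<noteq> y" using consec_next_prev_neq[OF q(2) y(1) x(1)] by simp
    then show False using four_nbs[OF w(1,2) x(2) y(2)] ne w x(1) y(1) by auto
  qed
  have uniq: "w1 = w2" if w: "{v, w1} \<in> N" "{v, w2} \<in> N" for v w1 w2
  proof (cases "v = hd q \<or> v = last q")
    case True
    show ?thesis
    proof (rule ccontr)
      assume ne: "w1 \<noteq> w2"
      have vU: "v \<in> U" using w N_iff by blast
      have "v \<noteq> hd q \<or> v \<noteq> last q" using q(5) by blast
      then obtain x where x: "consec q v x \<or> consec q x v" "adj v x" "x \<in> U" using nexts prevs vU by blast
      have "mate v \<notin> U" using out True .
      then show False using four_nbs[of v w1 w2 x "mate v"] w x ne adj_mate[of v] vU UV by (auto simp: N_iff)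
    qed
  qed (use inner[of v w1 w2] w N_iff in blast)
  have link: "v = hd q" if v: "v \<in> U \<inter> \<Union> N" "mate v \<notin> U \<union> P" for v
  proof (rule ccontr)
    assume "v \<noteq> hd q"
    moreover have "v \<noteq> last q" using v(2) ends(2) by auto
    moreover obtain w where w: "{v, w} \<in> N" using v(1) N_ex by blast
    moreover have "\<not> consec q v (mate v)" "\<not> consec q (mate v) v" "w \<noteq> mate v"
      using consec_in[of q] q(4) v(2) w N_iff by auto
    ultimately show False using inner[of v w "mate v"] v(1) w N_iff adj_mate[of v] UV by blast
  qed
  have hdU: "hd q \<in> U" using q by auto
  have path: "successively (\<lambda>a b. {a, b} \<in> E - N) q"
  proof (rule ccontr)
    assume "\<not> ?thesis"
    then obtain a b where ab: "consec q a b" "{a, b} \<notin> E - N" using not_successively_consec by fastforce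
    then have "{a, b} \<in> N" using consec_succ[OF q(3) ab(1)] by blast
    then show False using ab(1) N_iff by blast
  qed
  have "reach (\<lambda>a b. {a, b} \<in> E - N) (U - {}) w (hd q)" if "w \<in> U - {}" for w
    by (rule reach_path[OF path]) (use q that hdU in \<open>auto simp: symp_def insert_commute\<close>)
  moreover have "e \<inter> f = {}" if ef: "e \<in> N" "f \<in> N" "e \<noteq> f" for e f
  proof (rule ccontr)
    assume "e \<inter> f \<noteq> {}"
    then obtain v where "v \<in> e" "v \<in> f" by blast
    then obtain w1 w2 where "e = {v, w1}" "f = {v, w2}" "{v, w1} \<in> N" "{v, w2} \<in> N" using N_ex ef by meson
    then show False using uniq ef(3) by blast
  qed
  moreover have "N \<subseteq> E" "\<forall>e\<in>N. e \<subseteq> U" by (auto simp: N_def)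
  moreover have "consec q a b \<or> consec q b a" if "a \<in> U" "b \<in> U" "{a, b} \<in> E - N" for a b
    using that N_iff by blast
  ultimately have "piece P U {} N q"
    unfolding piece_def using q link ends(1) hdU by auto
  then show ?thesis by blast
qed

text \<open>If no vertex of \<open>U\<close> is matched into \<open>P\<close>, the whole cycle is a
  legitimate start for \<open>induced_cycle\<close>, as it leaves nothing behind in
  \<open>U\<close>. Otherwise \<open>s\<close> is the only such vertex and must stay off
  \<open>D\<close>: an edge between \<open>D\<close> and \<open>P\<close> would raise a degree in
  the induced 2-regular graph. By \<open>card_feet\<close> another exit exists, so \<open>R\<close>
  is nonempty.\<close>

lemma outer_piece:
  assumes U: "U \<in> Os" and P: "P \<subseteq> C" "P \<noteq> {}"
    and one: "\<And>u u'. u \<in> U \<Longrightarrow> u' \<in> U \<Longrightarrow> mate u \<in> P \<Longrightarrow> mate u' \<in> P \<Longrightarrow> u = u'"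
  shows "\<exists>D N q. piece P U D N q \<and> (\<forall>a\<in>D. card {b \<in> D. adj a b} = 2) \<and> (\<forall>a\<in>D. mate a \<notin> P)"
proof -
  obtain c where c: "cyc cadj c" "set c = U" using outer U by blast
  have UV: "U \<subseteq> V" "V - U \<noteq> {}" using outer_V[OF U] outer_center[OF U] P cover by blast+
  have cadj: "cyc adj p" if "cyc cadj p" for p
    using that successively_mono[of cadj p adj] by (auto simp: cyc_def)
  show ?thesis
  proof (cases "\<exists>s\<in>U. mate s \<in> P")
    case False
    define R where "R = {r \<in> U. exits U r}"
    have "rest_reaches U R (set c)" by (simp add: rest_reaches_def c(2))
    then obtain D where D: "D \<subseteq> set c" "D \<noteq> {}" "\<forall>a\<in>D. card {b \<in> D. adj a b} = 2" "rest_reaches U R D"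
      using induced_cycle[OF cadj[OF c(1)] _ UV, of R] c(2) by (auto simp: R_def)
    have "\<exists>N q. piece P U D N q"
      using D c(2) False exits_outer[OF U] by (intro broken_piece[OF U _ D(2) _ D(4)]) (auto simp: R_def)
    then show ?thesis using D c(2) False by blast
  next
    case True
    then obtain s where s: "s \<in> U" "mate s \<in> P" by blast
    have exs: "exits U s" using exits_outer[OF U s(1)] s(2) P by blast
    define R where "R = {r \<in> U. exits U r \<and> r \<noteq> s}"
    have RP: "mate r \<in> C - P" if "r \<in> R" for r
      using that exits_outer[OF U] one[of r s] s by (auto simp: R_def)
    have "\<not> {x \<in> C. mate x \<in> U} \<subseteq> {mate s}"
    proof
      assume "{x \<in> C. mate x \<in> U} \<subseteq> {mate s}"
      then have "card {x \<in> C. mate x \<in> U} \<le> card {mate s}" by (intro card_mono) auto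
      then show False using card_feet[OF U] by simp
    qed
    then obtain x where x: "x \<in> C" "mate x \<in> U" "x \<noteq> mate s" by blast
    have mx: "mate (mate x) = x" using x(1) cover by (intro mate_mate) simp
    then have "mate x \<in> R" using x exits_outer[OF U x(2)] by (auto simp: R_def)
    then have "R \<noteq> {}" by blast
    then consider q where "q \<noteq> []" "distinct q" "successively adj q" "set q = U" "hd q = s" "last q \<in> R"
      | p where "cyc adj p" "set p \<subseteq> U - {s}" "rest_reaches U R (set p)"
      using path_or_cycle[OF c s(1) exs R_def] by blast
    then show ?thesis
    proof cases
      case 1
      have "last q \<noteq> s" using 1(6) by (simp add: R_def)
      moreover have "successively adj (rev q)" using 1(3) by (simp add: insert_commute)
      \<comment> \<open>Reversed, because \<open>piece\<close> wants the end linked to the surviving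
        part of the centre at the head and \<open>s\<close> at the other end.\<close>
      ultimately have "\<exists>N. piece P U {} N (rev q)"
        using 1 RP s(2) by (intro path_piece[OF U P(1)]) (auto simp: hd_rev last_rev)
      then show ?thesis by (meson empty_iff)
    next
      case 2
      have "set p \<subseteq> U" using 2(2) by blast
      then obtain D where D: "D \<subseteq> set p" "D \<noteq> {}" "\<forall>a\<in>D. card {b \<in> D. adj a b} = 2" "rest_reaches U R D"
        using induced_cycle[OF 2(1) _ UV 2(3)] 2(2) by (auto simp: R_def)
      have "\<exists>N q. piece P U D N q"
        using D 2(2) RP by (intro broken_piece[OF U _ D(2) _ D(4)]) (auto simp: R_def)
      moreover have "mate a \<notin> P" if "a \<in> D" for a
        using one[of a s] s that D(1) 2(2) by blast
      ultimately show ?thesis using D(3) by blast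
    qed
  qed
qed

lemma pieceD:
  assumes "piece P U D N q"
  shows "D \<subseteq> U" "distinct q" "set q = U" "N \<subseteq> E" "e \<in> N \<Longrightarrow> e \<subseteq> U - D"
    "e \<in> N \<Longrightarrow> f \<in> N \<Longrightarrow> e \<noteq> f \<Longrightarrow> e \<inter> f = {}"
    "a \<in> U - D \<Longrightarrow> b \<in> U - D \<Longrightarrow> {a, b} \<in> E - N \<Longrightarrow>
       {a, b} \<notin> M \<or> a \<in> \<Union> N \<or> b \<in> \<Union> N \<Longrightarrow> consec q a b \<or> consec q b a"
    "a \<in> U \<inter> \<Union> N \<Longrightarrow> mate a \<notin> U \<union> P \<Longrightarrow> a = hd q"
    "w \<in> U - D \<Longrightarrow> \<exists>r\<in>U - D. mate r \<in> C - P \<and> reach (\<lambda>a b. {a, b} \<in> E - N) (U - D) w r"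
proof -
  note a = assms[unfolded piece_def]
  note b = a[THEN conjunct2, THEN conjunct2, THEN conjunct2, THEN conjunct2]
  show "D \<subseteq> U" "distinct q" "set q = U" "N \<subseteq> E" using a by simp_all
  show "e \<in> N \<Longrightarrow> e \<subseteq> U - D" using b[THEN conjunct1] by simp
  show "e \<in> N \<Longrightarrow> f \<in> N \<Longrightarrow> e \<noteq> f \<Longrightarrow> e \<inter> f = {}" using b[THEN conjunct2, THEN conjunct1] by simp
  note c = b[THEN conjunct2, THEN conjunct2]
  show "a \<in> U - D \<Longrightarrow> b \<in> U - D \<Longrightarrow> {a, b} \<in> E - N \<Longrightarrow>
       {a, b} \<notin> M \<or> a \<in> \<Union> N \<or> b \<in> \<Union> N \<Longrightarrow> consec q a b \<or> consec q b a"
    using c[THEN conjunct1, THEN bspec, THEN bspec] by blast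
  show "a \<in> U \<inter> \<Union> N \<Longrightarrow> mate a \<notin> U \<union> P \<Longrightarrow> a = hd q"
    by (rule c[THEN conjunct2, THEN conjunct1, THEN bspec, THEN mp])
  show "w \<in> U - D \<Longrightarrow> \<exists>r\<in>U - D. mate r \<in> C - P \<and> reach (\<lambda>a b. {a, b} \<in> E - N) (U - D) w r"
    by (rule c[THEN conjunct2, THEN conjunct2, THEN bspec])
qed

text \<open>The lists are combined into one ranking for \<open>decomposition\<close>. The head of
  \<open>ps\<close> lies on \<open>VH\<close>, so the cut-open centre is a linear order, and each
  outer list hangs off it by at most one forced link at its head.\<close>

lemma assemble:
  assumes G: "vertices G = V" "edges G = E"
    and c: "cyc cadj (ps @ qs)" "set (ps @ qs) = C" "ps \<noteq> []" "qs \<noteq> []"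
    and piece: "\<And>U. U \<in> Os \<Longrightarrow> piece (set ps) U (D U) (N U) (q U)"
    and VH: "VH = set ps \<union> (\<Union>U\<in>Os. D U)" "\<And>v. v \<in> VH \<Longrightarrow> card {w \<in> VH. adj v w} = 2"
  shows "\<exists>T H N. three_decomposition G T H N"
proof -
  define N0 where "N0 = (\<Union>U\<in>Os. N U)"
  define blk where "blk v = (SOME U. U \<in> Os \<and> v \<in> U)" for v
  \<comment> \<open>The offset ranks all outer vertices above the centre, so a forced edge into the
    centre goes down. Ranks of different outer cycles are never compared along an edge, as no edge
    joins two outer cycles.\<close>
  define rk where "rk v = (if v \<in> C then pos (ps @ qs) v else length (ps @ qs) + pos (q (blk v)) v)" for v
  have p: "D U \<subseteq> U" "distinct (q U)" "set (q U) = U" "N U \<subseteq> E" "\<And>e. e \<in> N U \<Longrightarrow> e \<subseteq> U - D U"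
     "\<And>e f. e \<in> N U \<Longrightarrow> f \<in> N U \<Longrightarrow> e \<noteq> f \<Longrightarrow> e \<inter> f = {}"
     "\<And>a b. a \<in> U - D U \<Longrightarrow> b \<in> U - D U \<Longrightarrow> {a, b} \<in> E - N U \<Longrightarrow>
         {a, b} \<notin> M \<or> a \<in> \<Union> (N U) \<or> b \<in> \<Union> (N U) \<Longrightarrow> consec (q U) a b \<or> consec (q U) b a"
     "\<And>a. a \<in> U \<inter> \<Union> (N U) \<Longrightarrow> mate a \<notin> U \<union> set ps \<Longrightarrow> a = hd (q U)"
     "\<And>w. w \<in> U - D U \<Longrightarrow> \<exists>r\<in>U - D U. mate r \<in> C - set ps \<and> reach (\<lambda>a b. {a, b} \<in> E - N U) (U - D U) w r"
    if "U \<in> Os" for U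
    by (fact pieceD[OF piece[OF that]])+
  have blk: "blk v = U" if "U \<in> Os" "v \<in> U" for U v
  proof -
    have "blk v \<in> Os \<and> v \<in> blk v" unfolding blk_def by (rule someI[of _ U]) (use that in simp)
    then show ?thesis using outer_disj[of "blk v" U] that by blast
  qed
  have dC: "distinct (ps @ qs)" using c(1) by (simp add: cyc_def)
  have hdC: "hd (ps @ qs) = hd ps" "hd ps \<in> set ps" using c(3) by simp_all
  have psC: "set ps \<subseteq> C" "set qs \<subseteq> C" using c(2) by auto
  have inU: "v \<in> VH \<longleftrightarrow> v \<in> D U" if U: "U \<in> Os" "v \<in> U" for U v
  proof -
    have "v \<notin> set ps" using U outer_center psC by blast
    moreover have "v \<notin> D U'" if "U' \<in> Os" "U' \<noteq> U" for U'
      using p(1)[OF that(1)] outer_disj[OF that(1) U(1)] that(2) U(2) by blast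
    ultimately show ?thesis using VH(1) U by blast
  qed
  have inC: "v \<in> VH \<longleftrightarrow> v \<in> set ps" if "v \<in> C" for v
    using that outer_center p(1) VH(1) by blast
  have N0U: "v \<in> \<Union> N0 \<longleftrightarrow> v \<in> \<Union> (N U)" if U: "U \<in> Os" "v \<in> U" for U v
  proof
    assume "v \<in> \<Union> N0"
    then obtain U' e where e: "U' \<in> Os" "e \<in> N U'" "v \<in> e" by (auto simp: N0_def)
    then have "U' = U" using p(5)[OF e(1,2)] outer_disj[OF e(1) U(1)] U(2) by blast
    then show "v \<in> \<Union> (N U)" using e by blast
  qed (use U in \<open>auto simp: N0_def\<close>)
  have N0C: "v \<notin> \<Union> N0" if v: "v \<in> C" for v
  proof
    assume "v \<in> \<Union> N0"
    then obtain U' e where e: "U' \<in> Os" "e \<in> N U'" "v \<in> e" by (auto simp: N0_def)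
    then show False using p(5)[OF e(1,2)] outer_center[OF e(1)] v by blast
  qed
  have edgeU: "{a, b} \<in> N0 \<longleftrightarrow> {a, b} \<in> N U" if U: "U \<in> Os" "a \<in> U" for U a b
  proof
    assume "{a, b} \<in> N0"
    then obtain U' where e: "U' \<in> Os" "{a, b} \<in> N U'" by (auto simp: N0_def)
    then have "U' = U" using p(5)[OF e] outer_disj[OF e(1) U(1)] U(2) by blast
    then show "{a, b} \<in> N U" using e by blast
  qed (use U in \<open>auto simp: N0_def\<close>)
  show ?thesis
  proof (rule decomposition[OF G])
    show "VH \<subseteq> V" using VH(1) psC(1) cover p(1) by blast
    show "card {w \<in> VH. adj v w} = 2" if "v \<in> VH" for v using VH(2) that .
    show "N0 \<subseteq> E" using p(4) by (auto simp: N0_def)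
    show "e \<inter> f = {}" if ef: "e \<in> N0" "f \<in> N0" "e \<noteq> f" for e f
    proof -
      obtain U U' where U: "U \<in> Os" "e \<in> N U" "U' \<in> Os" "f \<in> N U'" using ef by (auto simp: N0_def)
      show ?thesis
      proof (cases "U = U'")
        case False
        then show ?thesis using p(5)[OF U(1,2)] p(5)[OF U(3,4)] outer_disj[OF U(1,3)] by blast
      qed (use p(6) U ef(3) in blast)
    qed
    show "e \<inter> VH = {}" if e: "e \<in> N0" for e
    proof -
      obtain U where U: "U \<in> Os" "e \<in> N U" using e by (auto simp: N0_def)
      then show ?thesis using p(5)[OF U] inU[OF U(1)] by blast
    qed
    have qsV: "set qs \<subseteq> V - VH" using psC inC cover dC by auto
    then show "V - VH \<noteq> {}" using c(4) by (cases qs) auto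
    define r where "r = (\<lambda>a b. {a, b} \<in> E - N0)"
    have sym: "symp r" by (auto simp: symp_def r_def insert_commute)
    have "successively cadj qs" using c(1) by (simp add: cyc_def successively_append_iff)
    then have sq: "successively r qs"
    proof (rule successively_mono)
      fix a b assume "a \<in> set qs" "b \<in> set qs" "cadj a b"
      then show "r a b" using N0C[of a] psC by (auto simp: r_def)
    qed
    \<comment> \<open>The arc \<open>qs\<close> survives as an unbroken path, since neither
      \<open>VH\<close> nor \<open>N0\<close> touches it, and every surviving vertex outside the
      centre walks to it by the last clause of \<open>piece\<close>.\<close>
    have toq: "reach r (V - VH) w (hd qs)" if w: "w \<in> V - VH" for w
    proof (cases "w \<in> C")
      case True
      then have "w \<in> set qs" using c(2) inC w by auto
      then show ?thesis using c(4) by (intro reach_path[OF sq qsV sym]) auto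
    next
      case False
      then obtain U where U: "U \<in> Os" "w \<in> U" using w cover by blast
      have UD: "x \<in> V - VH" if "x \<in> U - D U" for x
        using that inU[OF U(1)] outer_V[OF U(1)] by blast
      obtain x where x: "x \<in> U - D U" "mate x \<in> C - set ps" "reach (\<lambda>a b. {a, b} \<in> E - N U) (U - D U) w x"
        using p(9)[OF U(1), of w] U(2) w inU[OF U] by blast
      have "reach r (V - VH) w x"
        using UD by (rule_tac reach_mono[OF x(3)]) (auto simp: r_def edgeU[OF U(1)])
      moreover have mq: "mate x \<in> set qs" using x(2) c(2) by auto
      have xV: "x \<in> V" using x(1) UD by blast
      have "reach r (V - VH) x (mate x)"
        using UD[OF x(1)] qsV mq adj_mate[OF xV] N0C[of "mate x"] x(2) by (intro reach_step) (auto simp: r_def)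
      moreover have "reach r (V - VH) (mate x) (hd qs)"
        using c(4) mq by (intro reach_path[OF sq qsV sym]) auto
      ultimately show ?thesis using reach_trans by metis
    qed
    show "reach (\<lambda>a b. {a, b} \<in> E - N0) (V - VH) v w" if "v \<in> V - VH" "w \<in> V - VH" for v w
      using reach_trans[OF toq[OF that(1)] reach_sym[OF sym toq[OF that(2)]]] unfolding r_def .
    \<comment> \<open>Forced neighbours of no larger rank: the predecessor in the list, or, only for
      the head of an outer list, its mate. A head has no predecessor, so at most one such neighbour
      exists.\<close>
    have key: "(v \<in> C \<and> consec (ps @ qs) w v) \<or>
        (\<exists>U\<in>Os. v \<in> U \<and> (consec (q U) w v \<and> w \<in> U \<or> w = mate v \<and> v = hd (q U)))"
      if vw: "{v, w} \<in> E - N0" "{v, w} \<notin> M \<or> v \<in> \<Union> N0 \<or> w \<in> \<Union> N0" "v \<in> V - VH" "w \<in> V - VH" "rk w \<le> rk v"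
      for v w
    proof (cases "v \<in> C")
      case True
      have "v \<in> set (ps @ qs)" using True c(2) by simp
      then have "rk v < length (ps @ qs)" using pos_less[of v "ps @ qs"] True by (simp add: rk_def)
      then have wC: "w \<in> C" using vw(5) by (auto simp: rk_def split: if_splits)
      then have "cadj v w" using vw(1,2) N0C True by blast
      moreover have "v \<noteq> hd (ps @ qs)" "w \<noteq> hd (ps @ qs)"
        using vw(3,4) inC[OF True] inC[OF wC] hdC by auto
      ultimately have "consec (ps @ qs) v w \<or> consec (ps @ qs) w v"
        using cadj_consec[OF c(1), of v w] True c(2) by blast
      moreover have "\<not> consec (ps @ qs) v w"
        using consec_pos[OF dC, of v w] vw(5) True wC by (auto simp: rk_def)
      ultimately show ?thesis using True by blast
    next
      case False
      then obtain U where U: "U \<in> Os" "v \<in> U" using vw(3) cover by blast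
      have vD: "v \<in> U - D U" using U vw(3) inU[OF U] by blast
      have eN: "{v, w} \<in> E - N U" using vw(1) edgeU[OF U] by blast
      show ?thesis
      proof (cases "w \<in> U")
        case True
        then have "w \<in> U - D U" using vw(4) inU[OF U(1) True] by blast
        then have "consec (q U) v w \<or> consec (q U) w v"
          using p(7)[OF U(1) vD _ eN] vw(2) N0U[OF U] N0U[OF U(1) True] by blast
        moreover have "w \<notin> C" using True outer_center[OF U(1)] by blast
        then have "\<not> consec (q U) v w"
          using consec_pos[OF p(2)[OF U(1)], of v w] vw(5) False blk[OF U] blk[OF U(1) True] by (auto simp: rk_def)
        ultimately show ?thesis using U True by blast
      next
        case False
        then have w: "w = mate v" "w \<in> C" using outer_nb[OF U] vw(1) by auto
        then have "{v, w} \<in> M" using mate_M vw(3) by simp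
        then have "v \<in> \<Union> (N U)" using vw(2) N0C[OF w(2)] N0U[OF U] by blast
        moreover have "mate v \<notin> U \<union> set ps" using False w vw(4) inC[OF w(2)] by auto
        ultimately have "v = hd (q U)" using p(8)[OF U(1)] U(2) by blast
        then show ?thesis using U w(1) by blast
      qed
    qed
    show "w = w'"
      if "{v, w} \<in> E - N0" "{v, w} \<notin> M \<or> v \<in> \<Union> N0 \<or> w \<in> \<Union> N0"
        "{v, w'} \<in> E - N0" "{v, w'} \<notin> M \<or> v \<in> \<Union> N0 \<or> w' \<in> \<Union> N0"
        "v \<in> V - VH" "w \<in> V - VH" "w' \<in> V - VH" "rk w \<le> rk v" "rk w' \<le> rk v" for v w w'
    proof -
      note k1 = key[OF that(1,2,5,6,8)] and k2 = key[OF that(3,4,5,7,9)]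
      show ?thesis
      proof (cases "v \<in> C")
        case True
        then have "consec (ps @ qs) w v" "consec (ps @ qs) w' v" using k1 k2 outer_center by blast+
        then show ?thesis using consec_pred_unique[OF dC] by blast
      next
        case False
        then obtain U where U: "U \<in> Os" "v \<in> U" using k1 by blast
        have same: "U' = U" if "U' \<in> Os" "v \<in> U'" for U' using blk[OF that] blk[OF U] by simp
        have "consec (q U) w v \<or> w = mate v \<and> v = hd (q U)" using k1 False same by blast
        moreover have "consec (q U) w' v \<or> w' = mate v \<and> v = hd (q U)" using k2 False same by blast
        ultimately show ?thesis
          using consec_pred_unique[OF p(2)[OF U(1)]] consec_hd[OF p(2)[OF U(1)]] by metis
      qed
    qed
  qed
qed

section \<open>Arcs of the centre and their linked ends\<close>

lemma cyc_interior:
  assumes c: "cyc cadj (ps @ qs)" and v: "v \<in> set ps" "v \<noteq> hd ps" "v \<noteq> last ps"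
  shows "\<exists>a b. a \<in> set ps \<and> b \<in> set ps \<and> {w. adj v w} = {a, b, mate v} \<and> distinct [a, b, mate v]"
proof -
  obtain xs ys where p: "ps = xs @ v # ys" using v by (meson split_list)
  then have ne: "xs \<noteq> []" "ys \<noteq> []" using v by (auto simp: hd_append)
  have "cyc cadj (v # ys @ qs @ xs)" using cyc_rotate[of cadj xs "v # ys @ qs"] c p by simp
  from cyc_nbs[OF this] show ?thesis using ne p
    by (intro exI[of _ "hd ys"] exI[of _ "last xs"]) auto
qed

lemma cyc_first:
  assumes c: "cyc cadj (ps @ qs)" and l: "length ps \<ge> 2" "qs \<noteq> []"
  shows "\<exists>a b. a \<in> set ps \<and> b \<in> set qs \<and> {w. adj (hd ps) w} = {a, b, mate (hd ps)} \<and> distinct [a, b, mate (hd ps)]"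
proof -
  obtain x xs where p: "ps = x # xs" "xs \<noteq> []" using l(1) by (cases ps; cases "tl ps") auto
  have "cyc cadj (x # xs @ qs)" using c p by simp
  from cyc_nbs[OF this] show ?thesis using p l(2)
    by (intro exI[of _ "hd xs"] exI[of _ "last qs"]) auto
qed

lemma cyc_last:
  assumes c: "cyc cadj (ps @ qs)" and l: "length ps \<ge> 2" "qs \<noteq> []"
  shows "\<exists>a b. a \<in> set ps \<and> b \<in> set qs \<and> {w. adj (last ps) w} = {a, b, mate (last ps)} \<and> distinct [a, b, mate (last ps)]"
proof -
  obtain x xs where p: "ps = xs @ [x]" "xs \<noteq> []" using l(1) by (cases ps rule: rev_cases; cases "butlast ps") auto
  have "cyc cadj (x # qs @ xs)" using cyc_rotate[of cadj xs "x # qs"] c p by simp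
  from cyc_nbs[OF this] show ?thesis using p l(2)
    by (intro exI[of _ "last xs"] exI[of _ "hd qs"]) auto
qed

lemma card_two:
  assumes "{w. adj v w} = {a, b, m}" "distinct [a, b, m]" "a \<in> S"
    and "b \<in> S \<and> m \<notin> S \<or> b \<notin> S \<and> m \<in> S"
  shows "card {w \<in> S. adj v w} = 2"
proof -
  have "{w \<in> S. adj v w} = S \<inter> {a, b, m}" using assms(1) by blast
  then have "{w \<in> S. adj v w} = {a, b} \<or> {w \<in> S. adj v w} = {a, m}" using assms(3,4) by auto
  then show ?thesis using assms(2) by auto
qed

text \<open>A shortest arc of the centre with linked ends has no other linked pair, so every other outer
  cycle sends at most one edge of \<open>M\<close> to it.\<close>

definition linked :: "'a \<Rightarrow> 'a \<Rightarrow> bool" where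
  "linked x y \<longleftrightarrow> x \<noteq> y \<and> (mate x = y \<or> (\<exists>U\<in>Os. mate x \<in> U \<and> mate y \<in> U))"

lemma linked_sym: "x \<in> V \<Longrightarrow> linked x y \<Longrightarrow> linked y x"
  unfolding linked_def using mate_mate by metis

text \<open>A vertex of the centre matched to an outer cycle shares that cycle with a further vertex
  of the centre, by \<open>card_feet\<close>.\<close>

lemma ex_linked:
  assumes "x \<in> C" shows "\<exists>y\<in>C. linked x y"
proof (cases "mate x \<in> C")
  case True
  have "x \<in> V" using assms cover by blast
  then have "x \<noteq> mate x" using adj_mate adj_neq by blast
  then show ?thesis using True by (auto simp: linked_def)
next
  case False
  have "x \<in> V" using assms cover by blast
  then obtain U where U: "U \<in> Os" "mate x \<in> U" using mate_V[of x] cover False by blast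
  have "\<not> {y \<in> C. mate y \<in> U} \<subseteq> {x}"
  proof
    assume "{y \<in> C. mate y \<in> U} \<subseteq> {x}"
    then have "card {y \<in> C. mate y \<in> U} \<le> card {x}" by (intro card_mono) auto
    then show False using card_feet[OF U(1)] by simp
  qed
  then show ?thesis using U by (auto simp: linked_def)
qed

text \<open>The complementary arc \<open>qs\<close> is carried along so that rotation applies to the
  whole cycle. It may be empty here, as linked ends may be neighbours on the centre whose arc goes
  all the way round; minimality excludes this later.\<close>

definition closed_arc :: "'a list \<Rightarrow> 'a list \<Rightarrow> bool" where
  "closed_arc ps qs \<longleftrightarrow> cyc cadj (ps @ qs) \<and> set (ps @ qs) = C \<and> length ps \<ge> 2 \<and> linked (hd ps) (last ps)"

lemma ex_closed_arc: "\<exists>ps qs. closed_arc ps qs"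
proof -
  obtain c where c: "cyc cadj c" "set c = C" using center by blast
  then obtain x q where x: "c = x # q" by (cases c) (auto simp: cyc_def)
  then obtain y where y: "y \<in> C" "linked x y" using ex_linked[of x] c(2) by auto
  then have "y \<in> set q" using x c(2) by (auto simp: linked_def)
  then obtain a b where "q = a @ y # b" by (meson split_list)
  then have "closed_arc (x # a @ [y]) b" using c x y by (simp add: closed_arc_def)
  then show ?thesis by blast
qed

lemma min_closed_arc:
  obtains ps qs where "closed_arc ps qs"
    "\<And>x y. x \<in> set ps \<Longrightarrow> y \<in> set ps \<Longrightarrow> linked x y \<Longrightarrow> {x, y} = {hd ps, last ps}"
proof -
  obtain ps qs where pq: "closed_arc ps qs" and min: "\<And>ps' qs'. closed_arc ps' qs' \<Longrightarrow> length ps \<le> length ps'"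
  proof -
    obtain p0 where "\<exists>qs. closed_arc p0 qs" using ex_closed_arc by blast
    from ex_has_least_nat[of "\<lambda>ps. \<exists>qs. closed_arc ps qs", OF this, of length]
    show thesis using that by blast
  qed
  \<comment> \<open>After rotation the stretch from \<open>x\<close> to \<open>y\<close> is itself
    an arc with linked ends, so minimality leaves nothing before \<open>x\<close> or after
    \<open>y\<close>.\<close>
  have ordered: "x = hd ps \<and> y = last ps" if xy: "linked x y" "ps = a @ x # m @ y # d" for x y a m d
  proof -
    have "cyc cadj ((x # m @ [y]) @ (d @ qs @ a))"
      using cyc_rotate[of cadj a "x # m @ y # d @ qs"] pq xy(2) by (simp add: closed_arc_def)
    then have "closed_arc (x # m @ [y]) (d @ qs @ a)"
      using pq xy by (auto simp: closed_arc_def)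
    from min[OF this] have "a = []" "d = []" using xy(2) by auto
    then show ?thesis using xy(2) by simp
  qed
  show thesis
  proof (rule that[OF pq])
    fix x y assume xy: "x \<in> set ps" "y \<in> set ps" "linked x y"
    have "x \<in> V" "x \<noteq> y" using xy pq cover by (auto simp: closed_arc_def linked_def)
    obtain a b where a: "ps = a @ x # b" using xy(1) by (meson split_list)
    show "{x, y} = {hd ps, last ps}"
    proof (cases "y \<in> set b")
      case True
      then obtain m d where "b = m @ y # d" by (meson split_list)
      then have "ps = a @ x # m @ y # d" using a by simp
      then have "x = hd ps \<and> y = last ps" by (rule ordered[OF xy(3)])
      then show ?thesis by simp
    next
      case False
      then have "y \<in> set a" using xy(2) a \<open>x \<noteq> y\<close> by auto
      then obtain m d where "a = m @ y # d" by (meson split_list)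
      then have "ps = m @ y # d @ x # b" using a by simp
      then have "y = hd ps \<and> x = last ps" by (rule ordered[OF linked_sym[OF \<open>x \<in> V\<close> xy(3)]])
      then show ?thesis by (simp add: insert_commute)
    qed
  qed
qed

lemma star_decomposition:
  assumes G: "vertices G = V" "edges G = E"
  shows "\<exists>T H N. three_decomposition G T H N"
proof -
  obtain ps qs where arc: "closed_arc ps qs"
    and only: "\<And>x y. x \<in> set ps \<Longrightarrow> y \<in> set ps \<Longrightarrow> linked x y \<Longrightarrow> {x, y} = {hd ps, last ps}"
    using min_closed_arc by metis
  define P where "P = set ps"
  define x0 where "x0 = hd ps"
  define y0 where "y0 = last ps"
  have c: "cyc cadj (ps @ qs)" "set (ps @ qs) = C" "length ps \<ge> 2" "linked x0 y0"
    using arc by (auto simp: closed_arc_def x0_def y0_def)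
  have ps: "ps \<noteq> []" using c(3) by auto
  have PC: "P \<subseteq> C" "P \<noteq> {}" "C \<subseteq> V" using c(2) ps cover by (auto simp: P_def)
  have xyP: "x0 \<in> P" "y0 \<in> P" "x0 \<noteq> y0" using ps c(4) by (auto simp: P_def x0_def y0_def linked_def)
  have only: "{x, y} = {x0, y0}" if "x \<in> P" "y \<in> P" "linked x y" for x y
    using only that by (simp add: P_def x0_def y0_def)
  have mm: "mate (mate x) = x" if "x \<in> P" for x using that PC mate_mate by blast
  have mU: "mate (mate u) = u" if "U \<in> Os" "u \<in> U" for U u using that outer_V mate_mate by blast
  \<comment> \<open>Two edges from the same outer cycle to \<open>P\<close> have linked ends in
    \<open>P\<close>, which must be \<open>x0\<close> and \<open>y0\<close>; then the outer cycle
    contains the mate of \<open>x0\<close>.\<close>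
  have one: "u = u'" if U: "U \<in> Os" "mate x0 \<notin> U" and u: "u \<in> U" "u' \<in> U" "mate u \<in> P" "mate u' \<in> P" for U u u'
  proof (rule ccontr)
    assume "u \<noteq> u'"
    then have "mate u \<noteq> mate u'" using mU[OF U(1)] u by metis
    then have "linked (mate u) (mate u')" using mU[OF U(1)] u U by (auto simp: linked_def)
    then have "{mate u, mate u'} = {x0, y0}" using only u by blast
    then have "x0 = mate u \<or> x0 = mate u'" by blast
    then show False using mU[OF U(1)] u(1,2) U(2) by auto
  qed
  show ?thesis
  proof (cases "mate x0 = y0")
    case True
    have "mate y0 = x0" using mm[OF xyP(1)] True by simp
    have mV: "{x0, y0} \<in> M" using mate_M[of x0] True xyP(1) PC by auto
    \<comment> \<open>If the arc were the whole centre, its closing edge would be the chord, in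
      \<open>M\<close> and outside \<open>M\<close> at once.\<close>
    have qs: "qs \<noteq> []"
    proof
      assume "qs = []"
      then have "{y0, x0} \<in> E - M" using c(1) by (simp add: cyc_def x0_def y0_def)
      then show False using mV by (simp add: insert_commute)
    qed
    have "\<forall>U\<in>Os. \<exists>D N q. piece P U D N q \<and> (\<forall>a\<in>D. card {b \<in> D. adj a b} = 2) \<and> (\<forall>a\<in>D. mate a \<notin> P)"
    proof
      fix U assume U: "U \<in> Os"
      have "mate x0 \<notin> U" using True xyP(2) PC outer_center[OF U] by blast
      from outer_piece[OF U PC(1,2) one[OF U this]]
      show "\<exists>D N q. piece P U D N q \<and> (\<forall>a\<in>D. card {b \<in> D. adj a b} = 2) \<and> (\<forall>a\<in>D. mate a \<notin> P)" by blast
    qed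
    then have "\<forall>U\<in>Os. \<exists>t. piece P U (fst t) (fst (snd t)) (snd (snd t)) \<and>
        (\<forall>a\<in>fst t. card {b \<in> fst t. adj a b} = 2) \<and> (\<forall>a\<in>fst t. mate a \<notin> P)" by simp
    then obtain f where f: "\<forall>U\<in>Os. piece P U (fst (f U)) (fst (snd (f U))) (snd (snd (f U))) \<and>
        (\<forall>a\<in>fst (f U). card {b \<in> fst (f U). adj a b} = 2) \<and> (\<forall>a\<in>fst (f U). mate a \<notin> P)"
      by (rule bchoice[THEN exE])
    define D N q where "D U = fst (f U)" and "N U = fst (snd (f U))" and "q U = snd (snd (f U))" for U
    have pc: "\<And>U. U \<in> Os \<Longrightarrow> piece P U (D U) (N U) (q U)"
      "\<And>U a. U \<in> Os \<Longrightarrow> a \<in> D U \<Longrightarrow> card {b \<in> D U. adj a b} = 2"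
      "\<And>U a. U \<in> Os \<Longrightarrow> a \<in> D U \<Longrightarrow> mate a \<notin> P"
      using f unfolding D_def N_def q_def by simp_all
    define VH where "VH = P \<union> (\<Union>U\<in>Os. D U)"
    have DU: "D U \<subseteq> U" if "U \<in> Os" for U using pieceD(1)[OF pc(1)[OF that]] .
    have noqs: "b \<notin> VH" if "b \<in> set qs" for b
      using that c(1,2) DU outer_center unfolding VH_def P_def cyc_def by auto
    have notD: "mate v \<notin> D U" if "v \<in> P" "U \<in> Os" for v U
      using pc(3)[OF that(2), of "mate v"] mm[OF that(1)] that(1) by auto
    have card: "card {w \<in> VH. adj v w} = 2" if v: "v \<in> VH" for v
    proof (cases "v \<in> P")
      case vP: True
      consider "v = x0" | "v = y0" | "v \<noteq> x0" "v \<noteq> y0" by blast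
      then show ?thesis
      proof cases
        case 1
        obtain a b where "a \<in> P" "b \<in> set qs" "{w. adj x0 w} = {a, b, mate x0}" "distinct [a, b, mate x0]"
          using cyc_first[OF c(1,3) qs] by (auto simp: x0_def P_def)
        then show ?thesis using card_two[of x0 a b "mate x0" VH] noqs 1 True xyP by (auto simp: VH_def)
      next
        case 2
        obtain a b where "a \<in> P" "b \<in> set qs" "{w. adj y0 w} = {a, b, mate y0}" "distinct [a, b, mate y0]"
          using cyc_last[OF c(1,3) qs] by (auto simp: y0_def P_def)
        then show ?thesis using card_two[of y0 a b "mate y0" VH] noqs 2 \<open>mate y0 = x0\<close> xyP by (auto simp: VH_def)
      next
        case 3
        obtain a b where ab: "a \<in> P" "b \<in> P" "{w. adj v w} = {a, b, mate v}" "distinct [a, b, mate v]"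
          using cyc_interior[OF c(1), of v] vP 3 by (auto simp: x0_def y0_def P_def)
        have "mate v \<notin> P"
        proof
          assume "mate v \<in> P"
          moreover have "v \<noteq> mate v" using adj_mate adj_neq vP PC by blast
          ultimately have "{v, mate v} = {x0, y0}" using only[OF vP] by (auto simp: linked_def)
          then show False using 3 by blast
        qed
        then have "mate v \<notin> VH" using notD[OF vP] by (auto simp: VH_def)
        then show ?thesis using card_two[OF ab(3,4), of VH] ab(1,2) by (auto simp: VH_def)
      qed
    next
      case vP: False
      then obtain U where U: "U \<in> Os" "v \<in> D U" using v by (auto simp: VH_def)
      have "w \<in> D U" if w: "w \<in> VH" "adj v w" for w
      proof (rule ccontr)
        assume "w \<notin> D U"
        moreover have "w \<notin> U'" if "U' \<in> Os" "U' \<noteq> U" for U'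
        proof
          assume "w \<in> U'"
          then have "w \<notin> U" "w \<notin> C" using outer_disj[OF that(1) U(1) that(2)] outer_center[OF that(1)] by blast+
          then show False using outer_nb[OF U(1) _ w(2)] DU[OF U(1)] U(2) by blast
        qed
        ultimately have "w \<in> P" using w(1) DU by (auto simp: VH_def)
        then have "w = mate v" using outer_nb(1)[OF U(1) _ w(2)] DU[OF U(1)] U(2) PC outer_center[OF U(1)] by blast
        then show False using pc(3)[OF U] \<open>w \<in> P\<close> by simp
      qed
      then have "{w \<in> VH. adj v w} = {w \<in> D U. adj v w}" using U by (auto simp: VH_def)
      then show ?thesis using pc(2)[OF U] by simp
    qed
    show ?thesis
      by (rule assemble[OF G c(1,2) ps qs, of D N q VH]) (use pc(1) card in \<open>auto simp: P_def VH_def\<close>)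
  next
    case False
    then obtain U0 where U0: "U0 \<in> Os" "mate x0 \<in> U0" "mate y0 \<in> U0" using c(4) by (auto simp: linked_def)
    define u where "u = mate x0"
    define v where "v = mate y0"
    have uv: "u \<in> U0" "v \<in> U0" "u \<noteq> v" "mate u = x0" "mate v = y0"
      using U0 mm[OF xyP(1)] mm[OF xyP(2)] xyP(3) by (auto simp: u_def v_def)
    \<comment> \<open>A third edge from \<open>U0\<close> to \<open>P\<close> would end at a vertex
      linked to \<open>x0\<close>, and that vertex can only be \<open>y0\<close>.\<close>
    have feet: "w = u \<or> w = v" if w: "w \<in> U0" "mate w \<in> P" for w
    proof (rule ccontr)
      assume ne: "\<not> ?thesis"
      have mw: "mate (mate w) = w" using mU U0(1) w(1) by blast
      then have "mate w \<noteq> x0" using ne uv by (auto simp: u_def)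
      then have "{mate w, x0} = {x0, y0}"
        using only[OF w(2) xyP(1)] U0 w mw by (auto simp: linked_def)
      then have "mate w = y0" using xyP(3) by (auto simp: doubleton_eq_iff)
      then show False using ne mw by (simp add: v_def)
    qed
    \<comment> \<open>\<open>U0\<close> has at least three edges to the centre but only two to
      \<open>P\<close>, so \<open>P\<close> is not the whole centre.\<close>
    have qs: "qs \<noteq> []"
    proof
      assume "qs = []"
      then have PC': "P = C" using c(2) by (simp add: P_def)
      have "{x \<in> C. mate x \<in> U0} \<subseteq> {x0, y0}"
      proof
        fix x assume x: "x \<in> {x \<in> C. mate x \<in> U0}"
        then have "mate x = u \<or> mate x = v" using feet[of "mate x"] mm[of x] PC' by auto
        then show "x \<in> {x0, y0}" using mm[of x] x PC' uv by auto
      qed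
      then have "card {x \<in> C. mate x \<in> U0} \<le> card {x0, y0}" by (intro card_mono) auto
      then show False using card_feet[OF U0(1)] xyP(3) by simp
    qed
    \<comment> \<open>Any path in \<open>U0\<close> from \<open>u\<close> to \<open>v\<close> will
      do as a start; following the cycle supplies one.\<close>
    obtain cy where cy: "cyc cadj cy" "set cy = U0" using outer U0(1) by blast
    obtain p where p: "cyc cadj (u # p)" "set (u # p) = U0" using cyc_start[OF cy(1), of u] cy(2) uv(1) by blast
    then have "v \<in> set p" using uv by auto
    then obtain p1 p2 where p12: "p = p1 @ v # p2" by (meson split_list)
    have "successively adj (u # p)" using p(1) successively_mono[of cadj "u # p" adj] by (auto simp: cyc_def)
    then have "successively adj ((u # p1 @ [v]) @ p2)" using p12 by simp
    then have "successively adj (u # p1 @ [v])" by (simp only: successively_append_iff)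
    then have path0: "is_path U0 u (u # p1 @ [v]) v"
      using p p12 by (auto simp: is_path_def cyc_def)
    have V0: "U0 \<subseteq> V" "V - U0 \<noteq> {}" using outer_V[OF U0(1)] outer_center[OF U0(1)] PC by blast+
    obtain W where W: "is_path U0 u W v"
      "\<And>a b. a \<in> set W \<Longrightarrow> b \<in> set W \<Longrightarrow> adj a b \<Longrightarrow> consec W a b \<or> consec W b a"
      "U0 - set W \<subseteq> escaping U0 W"
      using nonseparating_path[OF V0 path0] by metis
    have W': "W \<noteq> []" "hd W = u" "last W = v" "distinct W" "successively adj W" "set W \<subseteq> U0"
      using W(1) by (auto simp: is_path_def)
    have uvW: "u \<in> set W" "v \<in> set W" using W'(1-3) by auto
    have feetW: "mate w \<notin> P" if "w \<in> U0" "w \<noteq> u" "w \<noteq> v" for w using feet that by blast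
    have ok: "rest_reaches U0 {r \<in> U0. exits U0 r} (set W)"
      using W(3) unfolding rest_reaches_def escaping_def by auto
    \<comment> \<open>Exits left over by \<open>W\<close> differ from \<open>u\<close> and
      \<open>v\<close>, so by \<open>feet\<close> they are matched to \<open>C - P\<close> and the
      escaping vertices reach the surviving centre.\<close>
    have "\<exists>N q. piece P U0 (set W) N q"
    proof (rule broken_piece[OF U0(1) W'(6) _ _ ok])
      show "set W \<noteq> {}" using W'(1) by simp
      show "r \<in> U0 \<and> mate r \<in> C - P" if r: "r \<in> {r \<in> U0. exits U0 r} - set W" for r
      proof -
        have "r \<noteq> u" "r \<noteq> v" using r uvW by auto
        then show ?thesis using r feetW exits_outer[OF U0(1)] by auto
      qed
    qed
    moreover have "\<exists>D N q. piece P U D N q \<and> (\<forall>a\<in>D. card {b \<in> D. adj a b} = 2) \<and> (\<forall>a\<in>D. mate a \<notin> P)"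
      if U: "U \<in> Os" "U \<noteq> U0" for U
    proof -
      have "mate x0 \<notin> U" using U0(1,2) outer_disj[OF U(1) U0(1) U(2)] by blast
      from outer_piece[OF U(1) PC(1,2) one[OF U(1) this]] show ?thesis by blast
    qed
    ultimately have ex: "\<exists>D N q. piece P U D N q \<and> (U = U0 \<longrightarrow> D = set W) \<and>
        (U \<noteq> U0 \<longrightarrow> (\<forall>a\<in>D. card {b \<in> D. adj a b} = 2) \<and> (\<forall>a\<in>D. mate a \<notin> P))" if "U \<in> Os" for U
      using that by (cases "U = U0") auto
    then have "\<forall>U\<in>Os. \<exists>t. piece P U (fst t) (fst (snd t)) (snd (snd t)) \<and> (U = U0 \<longrightarrow> fst t = set W) \<and>
        (U \<noteq> U0 \<longrightarrow> (\<forall>a\<in>fst t. card {b \<in> fst t. adj a b} = 2) \<and> (\<forall>a\<in>fst t. mate a \<notin> P))" by simp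
    then obtain f where f: "\<forall>U\<in>Os. piece P U (fst (f U)) (fst (snd (f U))) (snd (snd (f U))) \<and>
        (U = U0 \<longrightarrow> fst (f U) = set W) \<and> (U \<noteq> U0 \<longrightarrow>
        (\<forall>a\<in>fst (f U). card {b \<in> fst (f U). adj a b} = 2) \<and> (\<forall>a\<in>fst (f U). mate a \<notin> P))"
      by (rule bchoice[THEN exE])
    define D N q where "D U = fst (f U)" and "N U = fst (snd (f U))" and "q U = snd (snd (f U))" for U
    have pc: "\<And>U. U \<in> Os \<Longrightarrow> piece P U (D U) (N U) (q U)"
      "D U0 = set W"
      "\<And>U a. U \<in> Os \<Longrightarrow> U \<noteq> U0 \<Longrightarrow> a \<in> D U \<Longrightarrow> card {b \<in> D U. adj a b} = 2"
      "\<And>U a. U \<in> Os \<Longrightarrow> U \<noteq> U0 \<Longrightarrow> a \<in> D U \<Longrightarrow> mate a \<notin> P"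
      using f U0(1) unfolding D_def N_def q_def by simp_all
    define VH where "VH = P \<union> (\<Union>U\<in>Os. D U)"
    have DU: "D U \<subseteq> U" if "U \<in> Os" for U using pieceD(1)[OF pc(1)[OF that]] .
    have noqs: "b \<notin> VH" if "b \<in> set qs" for b
      using that c(1,2) DU outer_center unfolding VH_def P_def cyc_def by auto
    have sub: "P \<subseteq> VH" "set W \<subseteq> VH" using pc(2) U0(1) by (auto simp: VH_def)
    have notD: "mate x \<notin> D U" if "x \<in> P" "U \<in> Os" "U \<noteq> U0" for x U
      using pc(4)[OF that(2,3), of "mate x"] mm[OF that(1)] that(1) by auto
    have local: "w \<in> P \<or> w \<in> D U" if U: "U \<in> Os" "z \<in> D U" and w: "w \<in> VH" "adj z w" for U z w
    proof (rule ccontr)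
      assume n: "\<not> ?thesis"
      then obtain U' where U': "U' \<in> Os" "w \<in> D U'" using w(1) by (auto simp: VH_def)
      have "U' \<noteq> U" using n U' by blast
      then have "w \<notin> U" "w \<notin> C"
        using outer_disj[OF U'(1) U(1)] outer_center[OF U'(1)] DU[OF U'(1)] U'(2) by blast+
      then show False using outer_nb[OF U(1) _ w(2)] DU[OF U(1)] U(2) by blast
    qed
    have mateP: "w = mate z" if U: "U \<in> Os" "z \<in> D U" and w: "w \<in> P" "adj z w" for U z w
      using outer_nb(1)[OF U(1) _ w(2)] DU[OF U(1)] U(2) w(1) PC outer_center[OF U(1)] by blast
    have card: "card {w \<in> VH. adj z w} = 2" if z: "z \<in> VH" for z
    proof (cases "z \<in> P")
      case zP: True
      consider "z = x0" | "z = y0" | "z \<noteq> x0" "z \<noteq> y0" by blast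
      then show ?thesis
      proof cases
        case 1
        obtain a b where "a \<in> P" "b \<in> set qs" "{w. adj x0 w} = {a, b, mate x0}" "distinct [a, b, mate x0]"
          using cyc_first[OF c(1,3) qs] by (auto simp: x0_def P_def)
        then show ?thesis using card_two[of x0 a b "mate x0" VH] noqs 1 uvW sub by (auto simp: u_def)
      next
        case 2
        obtain a b where "a \<in> P" "b \<in> set qs" "{w. adj y0 w} = {a, b, mate y0}" "distinct [a, b, mate y0]"
          using cyc_last[OF c(1,3) qs] by (auto simp: y0_def P_def)
        then show ?thesis using card_two[of y0 a b "mate y0" VH] noqs 2 uvW sub by (auto simp: v_def)
      next
        case 3
        obtain a b where ab: "a \<in> P" "b \<in> P" "{w. adj z w} = {a, b, mate z}" "distinct [a, b, mate z]"
          using cyc_interior[OF c(1), of z] zP 3 by (auto simp: x0_def y0_def P_def)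
        have "mate z \<notin> P"
        proof
          assume "mate z \<in> P"
          moreover have "z \<noteq> mate z" using adj_mate adj_neq zP PC by blast
          ultimately have "{z, mate z} = {x0, y0}" using only[OF zP] by (auto simp: linked_def)
          then show False using 3 by blast
        qed
        moreover have "mate z \<notin> U0"
        proof
          assume "mate z \<in> U0"
          then have "mate z = u \<or> mate z = v" using feet[of "mate z"] mm[OF zP] zP by simp
          then show False using mm[OF zP] uv 3 by auto
        qed
        moreover have "mate z \<notin> D U" if "U \<in> Os" for U
          using notD[OF zP that] DU[OF that] calculation(2) by blast
        ultimately have "mate z \<notin> VH" by (auto simp: VH_def)
        then show ?thesis using card_two[OF ab(3,4), of VH] ab(1,2) sub by auto
      qed
    next
      case zP: False
      then obtain U where U: "U \<in> Os" "z \<in> D U" using z by (auto simp: VH_def)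
      show ?thesis
      proof (cases "U = U0")
        case False
        have "w \<in> D U" if w: "w \<in> VH" "adj z w" for w
          using local[OF U w] mateP[OF U _ w(2)] pc(4)[OF U(1) False U(2)] by blast
        then have "{w \<in> VH. adj z w} = {w \<in> D U. adj z w}" using U by (auto simp: VH_def)
        then show ?thesis using pc(3)[OF U(1) False U(2)] by simp
      next
        case True
        then have zW: "z \<in> set W" using U(2) pc(2) by simp
        then have zU: "z \<in> U0" using W'(6) by blast
        \<comment> \<open>\<open>W\<close> is induced, so inside \<open>VH\<close> a vertex of
          \<open>W\<close> sees its neighbours along \<open>W\<close> and possibly its mate in
          \<open>P\<close>; the latter happens exactly at \<open>u\<close> and \<open>v\<close>,
          where a path neighbour is missing.\<close>
        have nb: "w \<in> VH \<and> adj z w \<longleftrightarrow> consec W z w \<or> consec W w z \<or> w = mate z \<and> mate z \<in> P" for w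
        proof
          assume w: "w \<in> VH \<and> adj z w"
          then show "consec W z w \<or> consec W w z \<or> w = mate z \<and> mate z \<in> P"
            using local[OF U, of w] mateP[OF U, of w] W(2)[OF zW, of w] pc(2) True by auto
        next
          assume "consec W z w \<or> consec W w z \<or> w = mate z \<and> mate z \<in> P"
          then show "w \<in> VH \<and> adj z w"
            using consec_in[of W z w] consec_in[of W w z] sub consec_succ[OF W'(5)] adj_sym[of w z]
              adj_mate[of z] zU V0(1) by blast
        qed
        have nx: "\<exists>x. consec W z x" if "z \<noteq> v" using ex_consec_next[OF zW] that W'(3) by simp
        have pv: "\<exists>x. consec W x z" if "z \<noteq> u" using ex_consec_prev[OF zW] that W'(2) by simp
        note un = consec_succ_unique[OF W'(4)] consec_pred_unique[OF W'(4)]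
        have dist: "x \<noteq> y" if "consec W x z" "consec W z y" for x y
          using consec_next_prev_neq[OF W'(4) that] .
        have mW: "mate z \<notin> set W" if "mate z \<in> P" using that PC outer_center[OF U0(1)] W'(6) by blast
        consider "z = u" | "z = v" | "z \<noteq> u" "z \<noteq> v" by blast
        then show ?thesis
        proof cases
          case 1
          then obtain x where x: "consec W z x" using nx uv by blast
          have "\<not> consec W y z" for y using consec_hd[OF W'(4)] W'(2) 1 by blast
          then have "w \<in> VH \<and> adj z w \<longleftrightarrow> w = x \<or> w = mate z" for w
            unfolding nb using x un(1)[of z] 1 uv(4) xyP(1) by auto
          then have "{w \<in> VH. adj z w} = {x, mate z}" by auto
          moreover have "x \<noteq> mate z" using consec_in[OF x] mW 1 uv(4) xyP(1) by auto
          ultimately show ?thesis by simp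
        next
          case 2
          then obtain x where x: "consec W x z" using pv uv by blast
          have "\<not> consec W z y" for y using consec_last[OF W'(4)] W'(3) 2 by blast
          then have "w \<in> VH \<and> adj z w \<longleftrightarrow> w = x \<or> w = mate z" for w
            unfolding nb using x un(2)[of _ z] 2 uv(5) xyP(2) by auto
          then have "{w \<in> VH. adj z w} = {x, mate z}" by auto
          moreover have "x \<noteq> mate z" using consec_in[OF x] mW 2 uv(5) xyP(2) by auto
          ultimately show ?thesis by simp
        next
          case 3
          obtain x where x: "consec W x z" using pv 3 by blast
          obtain y where y: "consec W z y" using nx 3 by blast
          have "w \<in> VH \<and> adj z w \<longleftrightarrow> w = x \<or> w = y" for w
            unfolding nb using x y un(2)[of _ z] un(1)[of z] feetW[OF zU 3] by auto
          then have "{w \<in> VH. adj z w} = {x, y}" by auto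
          then show ?thesis using dist[OF x y] by simp
        qed
      qed
    qed
    show ?thesis
      by (rule assemble[OF G c(1,2) ps qs, of D N q VH]) (use pc(1) card in \<open>auto simp: P_def VH_def\<close>)
  qed
qed

end

section \<open>From the graph definitions to the locales\<close>

lemma star_center:
  assumes S: "star_graph S" "finite (vertices S)"
    and e: "\<And>e. e \<in> edges S \<Longrightarrow> \<exists>a b. e = {a, b} \<and> a \<noteq> b \<and> a \<in> vertices S \<and> b \<in> vertices S"
  shows "\<exists>c \<in> vertices S. \<forall>e \<in> edges S. c \<in> e"
proof -
  define a where "a x y \<longleftrightarrow> {x, y} \<in> edges S" for x y
  have sym: "a x y \<Longrightarrow> a y x" for x y by (simp add: a_def insert_commute)
  have aV: "x \<in> vertices S \<and> y \<in> vertices S \<and> x \<noteq> y" if "a x y" for x y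
    using e[of "{x, y}"] that by (auto simp: a_def doubleton_eq_iff)
  have conn: "vertices S \<noteq> {}" "\<And>u v. u \<in> vertices S \<Longrightarrow> v \<in> vertices S \<Longrightarrow> \<exists>p. graph_walk S u p v"
    using S(1) by (auto simp: star_graph_def tree_graph_def connected_graph_def)
  have acyc: "\<not> cyc a p" for p
  proof
    assume p: "cyc a p"
    have "set p \<subseteq> vertices S"
    proof
      fix x assume "x \<in> set p"
      then obtain q where "cyc a (x # q)" using cyc_start[OF p] by metis
      then show "x \<in> vertices S" using aV by (auto simp: cyc_Cons_iff)
    qed
    then have "graph_cycle S p"
      using p by (auto simp: graph_cycle_def graph_walk_def cyc_def a_def[abs_def])
    then show False using S(1) by (auto simp: star_graph_def tree_graph_def)
  qed
  have no3: False if "a x y" "a y z" "a z x" for x y z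
    using acyc[of "[x, y, z]"] that aV by (auto simp: cyc_def)
  have no4: False if "a x y" "a y z" "a z w" "a w x" "x \<noteq> z" "y \<noteq> w" for x y z w
    using acyc[of "[x, y, z, w]"] that aV by (auto simp: cyc_def)
  have no5: False if "a x y" "a y z" "a z w" "a w s" "a s x" "x \<noteq> z" "x \<noteq> w" "y \<noteq> w" "y \<noteq> s" "z \<noteq> s" for x y z w s
    using acyc[of "[x, y, z, w, s]"] that aV by (auto simp: cyc_def)
  have no6: False if "a x y" "a y z" "a z w" "a w s" "a s t" "a t x" "distinct [x, y, z, w, s, t]" for x y z w s t
    using acyc[of "[x, y, z, w, s, t]"] that by (auto simp: cyc_def)
  \<comment> \<open>Finiteness makes \<open>Max\<close> an upper bound for distances and
    connectedness makes \<open>LEAST\<close> attained, so diameter two yields walks of at most three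
    vertices.\<close>
  have D2: "u = v \<or> a u v \<or> (\<exists>m. a u m \<and> a m v)" if uv: "u \<in> vertices S" "v \<in> vertices S" for u v
  proof -
    have "finite {graph_distance S u v |u v. u \<in> vertices S \<and> v \<in> vertices S}"
    proof (rule finite_subset)
      show "{graph_distance S u v |u v. u \<in> vertices S \<and> v \<in> vertices S} \<subseteq>
          (\<lambda>(u, v). graph_distance S u v) ` (vertices S \<times> vertices S)" by auto
    qed (use S(2) in simp)
    then have "graph_distance S u v \<le> graph_diameter S" unfolding graph_diameter_def
      by (rule Max_ge) (use uv in blast)
    then have d: "graph_distance S u v \<le> 2" using S(1) by (simp add: star_graph_def)
    obtain p0 where p0: "graph_walk S u p0 v" using conn(2) uv by blast
    then have "length p0 = Suc (length p0 - 1)" by (cases p0) (auto simp: graph_walk_def)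
    then have "\<exists>p. graph_walk S u p v \<and> length p = Suc (graph_distance S u v)"
      unfolding graph_distance_def using p0 by (intro LeastI_ex[of "\<lambda>n. \<exists>p. graph_walk S u p v \<and> length p = Suc n"]) blast
    then obtain p where p: "graph_walk S u p v" "length p \<le> 3" using d by auto
    then consider x where "p = [x]" | x y where "p = [x, y]" | x y z where "p = [x, y, z]"
      by (cases p; cases "tl p"; cases "tl (tl p)"; cases "tl (tl (tl p))") (auto simp: graph_walk_def)
    then show ?thesis using p(1) by cases (auto simp: graph_walk_def a_def)
  qed
  show ?thesis
  proof (cases "\<exists>c x y. a c x \<and> a c y \<and> x \<noteq> y")
    case True
    then obtain c x y where c: "a c x" "a c y" "x \<noteq> y" by blast
    \<comment> \<open>If \<open>w\<close> missed \<open>c\<close>, its connections of length at most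
      two to \<open>x\<close> and \<open>y\<close> would avoid \<open>c\<close> and close a cycle of
      length four, five or six with \<open>x\<close>, \<open>c\<close> and \<open>y\<close>.\<close>
    have all: "a w c" if w: "w \<in> vertices S" "w \<noteq> c" for w
    proof (rule ccontr)
      assume n: "\<not> a w c"
      have wxy: "w \<noteq> x" "w \<noteq> y" using n c sym by blast+
      have far: "\<exists>m. m \<noteq> c \<and> a w m \<and> a m z" if z: "a c z" "\<not> a w z" "w \<noteq> z" for z
      proof -
        obtain m where "a w m" "a m z" using D2[of w z] w aV[OF z(1)] z by blast
        then show ?thesis using n by (intro exI[of _ m]) auto
      qed
      have xy: "\<not> a x y" using no3[of c x y] c sym by blast
      show False
      proof (cases "a w x"; cases "a w y")
        assume "a w x" "a w y"
        then show False using no4[of w x c y] c sym w(2) by blast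
      next
        assume 1: "a w x" "\<not> a w y"
        then obtain m where m: "m \<noteq> c" "a w m" "a m y" using far c wxy by blast
        have "m \<noteq> x" using m xy by blast
        then show False using no5[of w x c y m] 1 m c sym w(2) wxy by blast
      next
        assume 1: "\<not> a w x" "a w y"
        then obtain m where m: "m \<noteq> c" "a w m" "a m x" using far c wxy by blast
        have "m \<noteq> y" using m xy sym by blast
        then show False using no5[of w y c x m] 1 m c sym w(2) wxy by blast
      next
        assume 1: "\<not> a w x" "\<not> a w y"
        obtain m where m: "m \<noteq> c" "a w m" "a m x" using 1 far c wxy by blast
        obtain k where k: "k \<noteq> c" "a w k" "a k y" using 1 far c wxy by blast
        have mk: "m \<noteq> y" "k \<noteq> x" using m k 1 by blast+
        show False
        proof (cases "m = k")
          case True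
          then show False using no4[of m x c y] m k c sym by blast
        next
          case False
          have "distinct [w, m, x, c, y, k]" using aV[OF m(2)] aV[OF m(3)] aV[OF k(2)] aV[OF k(3)]
            aV[OF c(1)] aV[OF c(2)] m k mk wxy w(2) c(3) False by auto
          then show False using no6[of w m x c y k] m k c sym by blast
        qed
      qed
    qed
    \<comment> \<open>Both ends of an edge avoiding \<open>c\<close> are adjacent to
      \<open>c\<close>, which gives a triangle.\<close>
    have "c \<in> f" if f: "f \<in> edges S" for f
    proof (rule ccontr)
      assume "c \<notin> f"
      moreover obtain u w where "f = {u, w}" "u \<in> vertices S" "w \<in> vertices S" using e[OF f] by blast
      moreover from this have "a u w" using f by (simp add: a_def)
      ultimately show False using no3[of u w c] all[of u] all[of w] sym by blast
    qed
    then show ?thesis using aV[OF c(1)] by blast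
  next
    case False
    show ?thesis
    proof (cases "edges S = {}")
      case True
      then show ?thesis using conn(1) by auto
    next
      case False': False
      then obtain x y where "{x, y} \<in> edges S" using e by blast
      then have xy: "a x y" by (simp add: a_def)
      \<comment> \<open>No vertex has two neighbours here, so there is just one edge and either end
        serves as centre.\<close>
      have "x \<in> f" if f: "f \<in> edges S" for f
      proof (rule ccontr)
        assume xf: "x \<notin> f"
        obtain u w where uw: "f = {u, w}" "u \<in> vertices S" using e[OF f] by blast
        then have auw: "a u w" using f by (simp add: a_def)
        have ne: "x \<noteq> u" "x \<noteq> w" using xf uw by auto
        then consider "a x u" | m where "a x m" "a m u" using D2[of x u] aV[OF xy] uw(2) by blast
        then show False
        proof cases
          case 1
          then show False using False sym[OF 1] auw ne by blast
        next
          case 2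
          then show False using False sym[OF 2(1)] ne by blast
        qed
      qed
      then show ?thesis using aV[OF xy] by blast
    qed
  qed
qed

text \<open>A walk that starts in \<open>Q\<close> and avoids \<open>X\<close> can never leave
  \<open>Q\<close>, and after deleting \<open>X\<close> such walks lead to every remaining
  vertex.\<close>

lemma k_connected_separation:
  assumes k: "k_connected 3 G" and X: "X \<subseteq> vertices G" "card X < 3"
    and Q: "Q \<subseteq> vertices G" "Q \<noteq> {}" "Q \<inter> X = {}" "\<And>a b. a \<in> Q \<Longrightarrow> {a, b} \<in> edges G \<Longrightarrow> b \<in> Q \<union> X"
  shows "vertices G \<subseteq> Q \<union> X"
proof
  fix v assume v: "v \<in> vertices G"
  obtain u where u: "u \<in> Q" using Q(2) by blast
  show "v \<in> Q \<union> X"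
  proof (rule ccontr)
    assume n: "v \<notin> Q \<union> X"
    let ?D = "delete_vertices G X"
    have "connected_graph ?D" using k X by (simp add: k_connected_def)
    moreover have "u \<in> vertices ?D" "v \<in> vertices ?D" using u v n Q(1,3) by (auto simp: delete_vertices_def)
    ultimately obtain p where p: "graph_walk ?D u p v" unfolding connected_graph_def by blast
    have "set p \<subseteq> Q" if "successively (\<lambda>x y. {x, y} \<in> edges ?D) p" "p \<noteq> []" "hd p \<in> Q" for p
      using that
    proof (induction p rule: induct_list012)
      case (3 x y zs)
      have "{x, y} \<in> edges G" "y \<notin> X" using 3(3) by (auto simp: delete_vertices_def)
      then have "y \<in> Q" using Q(4)[of x y] 3(5) by auto
      then show ?case using 3 by auto
    qed auto
    then have "set p \<subseteq> Q" using p u by (auto simp: graph_walk_def)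
    moreover have "v \<in> set p" using p by (auto simp: graph_walk_def)
    ultimately show False using n by blast
  qed
qed

theorem theorem1:
  fixes G :: "'a ugraph"
  assumes "finite_simple_graph G"
    and "k_connected 3 G"
    and "star_like G"
  shows "\<exists>T H N. three_decomposition G T H N"
proof -
  obtain M where M: "perfect_matching_of M G" "star_graph (contraction_graph G M)" and cubic: "cubic_graph G"
    using assms(3) by (auto simp: star_like_def)
  interpret cubic_matched "vertices G" "edges G" M
  proof
    show "finite (vertices G)" "e \<in> edges G \<Longrightarrow> e \<subseteq> vertices G \<and> card e = 2" for e
      using assms(1) by (auto simp: finite_simple_graph_def)
    show "card {e \<in> edges G. v \<in> e} = 3" if "v \<in> vertices G" for v
      using cubic that by (simp add: cubic_graph_def regular_graph_def degree_of_def)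
    show "vertices G \<subseteq> Q \<union> X"
      if "X \<subseteq> vertices G" "card X < 3" "Q \<subseteq> vertices G" "Q \<noteq> {}" "Q \<inter> X = {}"
        "\<And>a b. a \<in> Q \<Longrightarrow> {a, b} \<in> edges G \<Longrightarrow> b \<in> Q \<union> X" for X Q
      by (rule k_connected_separation[OF assms(2)]) (use that in auto)
    show "M \<subseteq> edges G" "e \<in> M \<Longrightarrow> f \<in> M \<Longrightarrow> e \<noteq> f \<Longrightarrow> e \<inter> f = {}"
      "v \<in> vertices G \<Longrightarrow> \<exists>e\<in>M. v \<in> e" for e f v
      using M(1) by (auto simp: perfect_matching_of_def matching_of_def)
  qed
  have cyc_iff: "graph_cycle (delete_edges G M) p \<longleftrightarrow> cyc cadj p" for p
  proof
    assume "cyc cadj p"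
    then show "graph_cycle (delete_edges G M) p"
      using cyc_V[of p] by (auto simp: graph_cycle_def graph_walk_def cyc_def delete_edges_def)
  qed (auto simp: graph_cycle_def graph_walk_def cyc_def delete_edges_def)
  define \<C> where "\<C> = {set p | p. cyc cadj p}"
  have S: "vertices (contraction_graph G M) = \<C>"
    "edges (contraction_graph G M) = {{C, D} | C D. C \<in> \<C> \<and> D \<in> \<C> \<and> C \<noteq> D \<and> (\<exists>u\<in>C. \<exists>v\<in>D. {u, v} \<in> M)}"
    by (simp_all add: contraction_graph_def cyc_iff \<C>_def Let_def)
  have "\<C> \<subseteq> Pow (vertices G)" using cyc_V by (auto simp: \<C>_def)
  then have "finite \<C>" by (rule finite_subset) (simp add: fin)
  then have "\<exists>C \<in> vertices (contraction_graph G M). \<forall>e \<in> edges (contraction_graph G M). C \<in> e"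
  proof (intro star_center[OF M(2)])
    fix e assume "e \<in> edges (contraction_graph G M)"
    then obtain A B where "e = {A, B}" "A \<in> \<C>" "B \<in> \<C>" "A \<noteq> B" unfolding S(2) by auto
    then show "\<exists>A B. e = {A, B} \<and> A \<noteq> B \<and> A \<in> vertices (contraction_graph G M) \<and> B \<in> vertices (contraction_graph G M)"
      unfolding S(1) by (intro exI[of _ A] exI[of _ B]) simp
  qed (simp add: S(1))
  then obtain C where C: "C \<in> \<C>" "\<And>e. e \<in> edges (contraction_graph G M) \<Longrightarrow> C \<in> e"
    unfolding S(1) by (rule bexE) simp
  have disj: "A = B" if AB: "A \<in> \<C>" "B \<in> \<C>" and v: "v \<in> A" "v \<in> B" for A B v
  proof -
    obtain p where p: "A = set p" "cyc cadj p" using AB(1) by (auto simp: \<C>_def)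
    obtain p' where p': "B = set p'" "cyc cadj p'" using AB(2) by (auto simp: \<C>_def)
    show ?thesis using cyc_overlap[OF p(2) p'(2), of v] cyc_overlap[OF p'(2) p(2), of v] v p(1) p'(1) by simp
  qed
  interpret star_matched "vertices G" "edges G" M C "\<C> - {C}"
  proof
    show "\<exists>c. cyc cadj c \<and> set c = C" using C(1) by (auto simp: \<C>_def)
    show "\<exists>c. cyc cadj c \<and> set c = U" if "U \<in> \<C> - {C}" for U using that by (auto simp: \<C>_def)
    show "U \<inter> C = {}" if "U \<in> \<C> - {C}" for U using disj[of U C] that C(1) by blast
    show "U \<inter> U' = {}" if "U \<in> \<C> - {C}" "U' \<in> \<C> - {C}" "U \<noteq> U'" for U U' using disj[of U U'] that by blast
    show "vertices G = C \<union> \<Union> (\<C> - {C})"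
    proof
      show "vertices G \<subseteq> C \<union> \<Union> (\<C> - {C})"
      proof
        fix v assume "v \<in> vertices G"
        then obtain p where "cyc cadj p" "v \<in> set p" using ex_cyc by blast
        then have "v \<in> \<Union> \<C>" by (auto simp: \<C>_def)
        then show "v \<in> C \<union> \<Union> (\<C> - {C})" by blast
      qed
    qed (use C(1) \<open>\<C> \<subseteq> Pow (vertices G)\<close> in blast)
    show "mate v \<in> C" if U: "U \<in> \<C> - {C}" "v \<in> U" "mate v \<notin> U" for U v
    proof -
      have v: "v \<in> vertices G" using U cyc_V by (auto simp: \<C>_def)
      \<comment> \<open>The mate lies on some cycle other than \<open>U\<close>. The two cycles form
        an edge of the star, which contains the centre, and \<open>U\<close> is not the
        centre.\<close>
      obtain p where p: "cyc cadj p" "mate v \<in> set p" using ex_cyc[OF mate_V[OF v]] by blast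
      then have "{U, set p} \<in> edges (contraction_graph G M)"
        unfolding S(2) using U mate_M[OF v] by (auto simp: \<C>_def)
      then have "C \<in> {U, set p}" by (rule C(2))
      then show ?thesis using U(1) p(2) by auto
    qed
  qed
  show ?thesis by (rule star_decomposition) simp_all
qed

end
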